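(* Let $p$ be a prime number and let $P$ be a finite abelian $p$-group of type $e$ (where $e \in E(n)$, $n \geq 1$). Then $$\mathrm{Spec}_{\Pi}(P) = \{p^{m} \mid m \in \{b(e) + c(e), \ldots, \Sigma(e)\}\}.$$
   Context: Types: for an integer $n \geq 1$, $E(n)$ is the set of $e=(e_1,\ldots,e_n)\in\mathbb{Z}^n$ with $1 \leq e_1 \leq e_2 \leq \cdots \leq e_n$. For a prime $p$, a finite abelian $p$-group is of type $e \in E(n)$ if it is isomorphic to $\bigoplus_{i=1}^n \mathbb{Z}/p^{e_i}\mathbb{Z}$. Put $\Sigma(e) = \sum_{i=1}^n e_i$. $\Pi$ and $\mathrm{Spec}_\Pi$: for a finite abelian $p$-group $P$ (written additively) and $i \in \mathbb{Z}$ coprime with $p$, let $\mu_i \in \mathrm{Aut}(P)$ be given by $\mu_i(x) = ix$. For an automorphism $\psi$, $\mathrm{Fix}(\psi)$ is its set of fixed points. For $\varphi \in \mathrm{Aut}(P)$ put $\Pi(\varphi) = \prod_{i=1}^{p-1} |\mathrm{Fix}(\mu_i \circ \varphi)|$, and put $\mathrm{Spec}_\Pi(P) = \{\Pi(\psi) \mid \psi \in \mathrm{Aut}(P)\}$. $abc$-decomposition: given $e \in E(n)$, its entries are decomposed into blocks as follows. Step 1: each maximal constant subsequence (of consecutive entries) of $e_1,\ldots,e_n$ of length at least $2$ forms one block, called an $a$-block. Step 2: among the remaining entries, starting from the left, one looks for successive entries $e_i, e_{i+1}$ (both not yet placed in a block) with $e_{i+1} = e_i + 1$; each such pair forms one block,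 called a $b$-block (the search is greedy from left to right and each entry belongs to at most one block). Step 3: each remaining entry forms a block by itself, called a $c$-block. The numbers of $a$-, $b$- and $c$-blocks are denoted $a(e)$, $b(e)$, $c(e)$. *)

theory Defs
  imports "HOL-Algebra.Algebra" "HOL-Computational_Algebra.Primes"
begin

section \<open>Types of finite abelian p-groups\<close>

text \<open>A tuple \<open>(e\<^sub>1, \<dots>, e\<^sub>n)\<close> is a list of length \<open>n\<close>; the entry \<open>e\<^sub>i\<close> is \<open>e ! (i - 1)\<close>.
  The entries are positive, hence natural numbers.\<close>

definition E :: "nat \<Rightarrow> nat list set" where
  "E n = {e. length e = n \<and> sorted e \<and> (\<forall>k\<in>set e. 1 \<le> k)}"

definition finite_abelian_p_group :: "nat \<Rightarrow> ('a, 'b) monoid_scheme \<Rightarrow> bool" where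
  "finite_abelian_p_group p P \<longleftrightarrow>
     comm_group P \<and> finite (carrier P) \<and> (\<exists>k. order P = p ^ k)"

definition of_type :: "nat \<Rightarrow> ('a, 'b) monoid_scheme \<Rightarrow> nat list \<Rightarrow> bool" where
  "of_type p P e \<longleftrightarrow> P \<cong> sum_group {..<length e} (\<lambda>i. integer_mod_group (p ^ (e ! i)))"

section \<open>The numbers \<open>\<Pi>(\<phi>)\<close> and their spectrum\<close>

text \<open>Groups are written multiplicatively in the library, so \<open>i x\<close> becomes the power \<open>x [^] i\<close>.\<close>

definition mu :: "('a, 'b) monoid_scheme \<Rightarrow> int \<Rightarrow> 'a \<Rightarrow> 'a" where
  "mu P i = (\<lambda>x\<in>carrier P. x [^]\<^bsub>P\<^esub> i)"

definition Fix :: "('a, 'b) monoid_scheme \<Rightarrow> ('a \<Rightarrow> 'a) \<Rightarrow> 'a set" where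
  "Fix P \<psi> = {x \<in> carrier P. \<psi> x = x}"

definition Pi_fix :: "nat \<Rightarrow> ('a, 'b) monoid_scheme \<Rightarrow> ('a \<Rightarrow> 'a) \<Rightarrow> nat" where
  "Pi_fix p P \<phi> = (\<Prod>i = 1..p - 1. card (Fix P (compose (carrier P) (mu P (int i)) \<phi>)))"

definition Spec_Pi :: "nat \<Rightarrow> ('a, 'b) monoid_scheme \<Rightarrow> nat set" where
  "Spec_Pi p P = {Pi_fix p P \<psi> | \<psi>. \<psi> \<in> auto P}"

section \<open>The abc-decomposition\<close>

text \<open>Blocks are represented by the sets of (0-based) positions of their entries.\<close>

definition constant_segment :: "nat list \<Rightarrow> nat set \<Rightarrow> bool" where
  "constant_segment e B \<longleftrightarrow>
     (\<exists>i j. B = {i..<j} \<and> j \<le> length e) \<and> (\<forall>k\<in>B. \<forall>l\<in>B. e ! k = e ! l)"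

definition a_blocks :: "nat list \<Rightarrow> nat set set" where
  "a_blocks e = {B. constant_segment e B \<and> 2 \<le> card B \<and>
                    (\<forall>C. constant_segment e C \<and> B \<subseteq> C \<longrightarrow> C = B)}"

definition b_candidate :: "nat list \<Rightarrow> nat \<Rightarrow> bool" where
  "b_candidate e i \<longleftrightarrow> Suc i < length e \<and> i \<notin> \<Union>(a_blocks e) \<and> Suc i \<notin> \<Union>(a_blocks e) \<and>
                       e ! Suc i = e ! i + 1"

text \<open>\<open>b_start e i\<close> says that the greedy search from left to right forms a b-block from the
  positions \<open>i\<close> and \<open>i + 1\<close>. When the search arrives at \<open>i\<close>, the only b-block formed earlier that
  can contain one of these two positions is the one starting at \<open>i - 1\<close>.\<close>

primrec b_start :: "nat list \<Rightarrow> nat \<Rightarrow> bool" where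
  "b_start e 0 \<longleftrightarrow> b_candidate e 0"
| "b_start e (Suc i) \<longleftrightarrow> b_candidate e (Suc i) \<and> \<not> b_start e i"

definition b_blocks :: "nat list \<Rightarrow> nat set set" where
  "b_blocks e = {{i, Suc i} | i. b_start e i}"

definition c_blocks :: "nat list \<Rightarrow> nat set set" where
  "c_blocks e = {{i} | i. i < length e \<and> i \<notin> \<Union>(a_blocks e) \<and> i \<notin> \<Union>(b_blocks e)}"

definition b_num :: "nat list \<Rightarrow> nat" where "b_num e = card (b_blocks e)"

definition c_num :: "nat list \<Rightarrow> nat" where "c_num e = card (c_blocks e)"

end

theory Submission
  imports Defs
begin

text \<open>
  Replace \<open>P\<close> by the direct sum \<open>G\<close> of the cyclic groups of order \<open>p ^ d i\<close>, where \<open>d i = e ! i\<close>, and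
  note that the fixed points of \<open>\<mu>\<^sub>k \<circ> \<phi>\<close> are the elements \<open>x\<close> with \<open>k \<phi>(x) = x\<close>: an eigenspace of \<open>\<phi>\<close> for the
  eigenvalue \<open>1 / k\<close>. Each eigenspace is a subgroup, so \<open>\<Pi>(\<phi>)\<close> is a power of \<open>p\<close>.

  Upper bound. The difference of two of the eigenvalues is a unit modulo \<open>p\<close>, so the eigenspaces for
  \<open>k = 1, \<dots>, p - 1\<close> are independent, as in linear algebra, and the product of their orders is at most the
  order \<open>p ^ \<Sigma>(e)\<close> of the group (\<open>prod_card_power_fixed_points_le_order\<close>).

  Lower bound. Call the first position of each b-block and each c-block a leader. There are
  \<open>b(e) + c(e)\<close> leaders; the exponent at a leader occurs nowhere else in \<open>e\<close>, and the exponents at two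
  leaders never differ by exactly one. Because the exponent at a leader \<open>t\<close> is unique, \<open>\<phi>\<close> acts on the
  corresponding one-dimensional layer of the group by a nonzero scalar modulo \<open>p\<close>, namely its diagonal
  entry at \<open>t\<close>, so \<open>k \<phi> - 1\<close> has diagonal entry zero modulo \<open>p\<close> for exactly one \<open>k\<close>. It remains to see that an
  endomorphism \<open>N\<close> whose diagonal entry vanishes modulo \<open>p\<close> at every element of a set \<open>T\<close> of leaders has a
  kernel of order at least \<open>p ^ |T|\<close> (\<open>card_kernel_ge_of_sparse\<close>). For this one writes down subgroups
  \<open>U \<subseteq> W\<close> with \<open>|W / U| = p ^ |T|\<close> and \<open>N(W) \<subseteq> U\<close>; then \<open>|W| \<le> |ker N| |U|\<close>.

  Realization. Automorphisms are assembled from blocks by taking direct sums, under which \<open>\<Pi>\<close> is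
  multiplicative, and sums of integer intervals are integer intervals. So it suffices that a single
  position of exponent \<open>k\<close> realizes all of \<open>1, \<dots>, k\<close> (multiplication by \<open>1 + p ^ m\<close>), that a b-block also
  realizes \<open>1\<close> (\<open>realizable_pair\<close>) and that an a-block also realizes \<open>1\<close> (the same construction) and
  \<open>0\<close> (a companion matrix of a polynomial without roots modulo \<open>p\<close>, \<open>realizable_constant_zero\<close>).
\<close>

section \<open>The blocks\<close>

lemma constant_segment_subset: "constant_segment e B \<Longrightarrow> B \<subseteq> {..<length e}"
  unfolding constant_segment_def by auto

lemma a_block_subset: "A \<in> a_blocks e \<Longrightarrow> A \<subseteq> {..<length e}"
  unfolding a_blocks_def using constant_segment_subset by blast

lemma a_block_interval:
  assumes "A \<in> a_blocks e"
  obtains i j where "A = {i..<j}" "i + 2 \<le> j" "\<And>k. k \<in> A \<Longrightarrow> e ! k = e ! i"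
proof -
  from assms have "constant_segment e A" and c: "2 \<le> card A" by (auto simp: a_blocks_def)
  then obtain i j where A: "A = {i..<j}" and eq: "\<forall>k\<in>A. \<forall>l\<in>A. e ! k = e ! l"
    unfolding constant_segment_def by blast
  from A c have "i + 2 \<le> j" by simp
  moreover from this A have "i \<in> A" by simp
  ultimately show ?thesis using A eq that[of i j] by blast
qed

lemma constant_segment_in_a_block:
  assumes "constant_segment e B" "2 \<le> card B"
  shows "B \<subseteq> \<Union>(a_blocks e)"
proof -
  \<comment> \<open>A constant segment containing \<open>B\<close> that is maximal for inclusion is an a-block.\<close>
  let ?S = "{C. constant_segment e C}"
  have "finite ?S"
    by (rule finite_subset[of _ "Pow {..<length e}"]) (use constant_segment_subset in auto)
  then obtain A where A: "constant_segment e A" "B \<subseteq> A"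
    and max: "\<And>C. constant_segment e C \<Longrightarrow> A \<subseteq> C \<Longrightarrow> A = C"
    using finite_has_maximal2[of ?S B] assms(1) by auto
  have "finite A" using constant_segment_subset[OF A(1)] finite_subset by blast
  then have "2 \<le> card A" using card_mono[OF _ A(2)] assms(2) by linarith
  with A max have "A \<in> a_blocks e" unfolding a_blocks_def by auto
  with A(2) show ?thesis by blast
qed

lemma a_blocks_disjoint:
  assumes A: "A \<in> a_blocks e" and B: "B \<in> a_blocks e" and x: "x \<in> A" "x \<in> B"
  shows "A = B"
proof -
  from A x have "constant_segment e A" "constant_segment e B" 
    using B by (auto simp: a_blocks_def)
  then obtain i j k l where ij: "A = {i..<j}" "j \<le> length e" and kl: "B = {k..<l}" "l \<le> length e"
    and eq: "\<And>y. y \<in> A \<Longrightarrow> e ! y = e ! x" "\<And>y. y \<in> B \<Longrightarrow> e ! y = e ! x"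
    using x unfolding constant_segment_def by blast
  have "A \<union> B = {min i k..<max j l}" using ij kl x by auto
  moreover have "max j l \<le> length e" using ij kl by simp
  moreover have "\<forall>y\<in>A \<union> B. \<forall>z\<in>A \<union> B. e ! y = e ! z"
    using eq by (metis Un_iff)
  ultimately have "constant_segment e (A \<union> B)" unfolding constant_segment_def by blast
  then have "A \<union> B = A" "A \<union> B = B" using A B unfolding a_blocks_def by blast+
  then show ?thesis by simp
qed

text \<open>Since \<open>e\<close> is sorted, all entries between two equal ones are equal to them; so a value occurring twice
  lies in a constant segment of length at least two.\<close>

lemma value_outside_a_blocks_unique:
  assumes "i < length e" "j < length e" "sorted e" "i \<notin> \<Union>(a_blocks e)" "e ! j = e ! i"
  shows "j = i"
proof (rule ccontr)
  assume "j \<noteq> i"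
  let ?a = "min i j" and ?b = "max i j"
  have "?b < length e" using assms by simp
  have "e ! k = e ! ?a" if "k \<in> {?a..<Suc ?b}" for k
  proof -
    have "e ! ?a \<le> e ! k" "e ! k \<le> e ! ?b" 
      using that \<open>?b < length e\<close> by (auto intro!: sorted_nth_mono[OF \<open>sorted e\<close>])
    moreover have "e ! ?a = e ! ?b" using assms(5) by (auto simp: min_def max_def)
    ultimately show ?thesis by simp
  qed
  then have "constant_segment e {?a..<Suc ?b}"
    unfolding constant_segment_def using \<open>?b < length e\<close> by (metis Suc_leI)
  moreover have "2 \<le> card {?a..<Suc ?b}" using \<open>j \<noteq> i\<close> by auto
  ultimately have "{?a..<Suc ?b} \<subseteq> \<Union>(a_blocks e)" by (rule constant_segment_in_a_block)
  moreover have "i \<in> {?a..<Suc ?b}" by auto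
  ultimately show False using assms(4) by blast
qed

lemma b_start_candidate: "b_start e i \<Longrightarrow> b_candidate e i"
  by (cases i) auto

lemma in_b_blocks_iff: "i \<in> \<Union>(b_blocks e) \<longleftrightarrow> b_start e i \<or> (\<exists>j. i = Suc j \<and> b_start e j)"
  unfolding b_blocks_def by auto

lemma singleton_in_c_blocks_iff:
  "{i} \<in> c_blocks e \<longleftrightarrow>
     i < length e \<and> i \<notin> \<Union>(a_blocks e) \<and> \<not> b_start e i \<and> (\<forall>j. i = Suc j \<longrightarrow> \<not> b_start e j)"
proof -
  have "{i} \<in> c_blocks e \<longleftrightarrow> i < length e \<and> i \<notin> \<Union>(a_blocks e) \<and> i \<notin> \<Union>(b_blocks e)"
    unfolding c_blocks_def by blast
  then show ?thesis unfolding in_b_blocks_iff by blast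
qed

lemma b_blocks_disjoint:
  assumes "A \<in> b_blocks e" "B \<in> b_blocks e" "x \<in> A" "x \<in> B"
  shows "A = B"
proof -
  from assms obtain i j where "A = {i, Suc i}" "b_start e i" "B = {j, Suc j}" "b_start e j"
    unfolding b_blocks_def by blast
  with assms(3,4) show ?thesis by auto
qed

lemma blocks_disjoint: "pairwise disjnt (a_blocks e \<union> b_blocks e \<union> c_blocks e)"
proof (rule pairwiseI)
  fix A B
  assume AB: "A \<in> a_blocks e \<union> b_blocks e \<union> c_blocks e" "B \<in> a_blocks e \<union> b_blocks e \<union> c_blocks e"
    and ne: "A \<noteq> B"
  have ab: "disjnt A B" if "A \<in> a_blocks e" "B \<in> b_blocks e" for A B
    using that b_start_candidate unfolding b_blocks_def b_candidate_def disjnt_def by auto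
  have c: "disjnt A B" if "A \<in> a_blocks e \<union> b_blocks e" "B \<in> c_blocks e" for A B
    using that unfolding c_blocks_def disjnt_def by auto
  have cc: "disjnt A B" if "A \<in> c_blocks e" "B \<in> c_blocks e"
    using that ne unfolding c_blocks_def disjnt_def by auto
  have aa: "disjnt A B" if "A \<in> a_blocks e" "B \<in> a_blocks e"
    using that ne a_blocks_disjoint unfolding disjnt_def by blast
  have bb: "disjnt A B" if "A \<in> b_blocks e" "B \<in> b_blocks e"
    using that ne b_blocks_disjoint unfolding disjnt_def by blast
  from AB show "disjnt A B"
    by (elim UnE) (use aa bb cc ab[of A B] ab[of B A] c[of A B] c[of B A] disjnt_sym in blast)+
qed

lemma blocks_cover: "\<Union>(a_blocks e \<union> b_blocks e \<union> c_blocks e) = {..<length e}"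
proof
  show "\<Union>(a_blocks e \<union> b_blocks e \<union> c_blocks e) \<subseteq> {..<length e}"
  proof (rule Union_least)
    fix B assume "B \<in> a_blocks e \<union> b_blocks e \<union> c_blocks e"
    then consider "B \<in> a_blocks e" | i where "B = {i, Suc i}" "b_start e i" | i where "B = {i}" "i < length e"
      unfolding b_blocks_def c_blocks_def by blast
    then show "B \<subseteq> {..<length e}"
    proof cases
      case 2
      then show ?thesis using b_start_candidate[of e i] by (auto simp: b_candidate_def)
    qed (use a_block_subset in auto)
  qed
next
  show "{..<length e} \<subseteq> \<Union>(a_blocks e \<union> b_blocks e \<union> c_blocks e)"
  proof
    fix i assume "i \<in> {..<length e}"
    then have "i \<in> \<Union>(a_blocks e) \<or> i \<in> \<Union>(b_blocks e) \<or> {i} \<in> c_blocks e"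
      unfolding c_blocks_def by blast
    then show "i \<in> \<Union>(a_blocks e \<union> b_blocks e \<union> c_blocks e)" by blast
  qed
qed

text \<open>This set witnesses the lower bound: it has one position in each block that is not an a-block, namely
  the first.\<close>

definition leaders :: "nat list \<Rightarrow> nat set" where
  "leaders e = {i. b_start e i \<or> {i} \<in> c_blocks e}"

lemma leader_less_length: "i \<in> leaders e \<Longrightarrow> i < length e"
  unfolding leaders_def using b_start_candidate[of e i] by (auto simp: b_candidate_def singleton_in_c_blocks_iff)

lemma leader_outside_a_blocks: "i \<in> leaders e \<Longrightarrow> i \<notin> \<Union>(a_blocks e)"
  unfolding leaders_def using b_start_candidate[of e i] by (auto simp: b_candidate_def singleton_in_c_blocks_iff)

lemma card_leaders: "card (leaders e) = b_num e + c_num e"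
proof -
  let ?B = "{i. b_start e i}" and ?C = "{i. {i} \<in> c_blocks e}"
  have "?B \<subseteq> {..<length e}" "?C \<subseteq> {..<length e}"
    using leader_less_length unfolding leaders_def by auto
  then have fin: "finite ?B" "finite ?C" using finite_subset by blast+
  have "?B \<inter> ?C = {}" by (auto simp: singleton_in_c_blocks_iff)
  moreover have "leaders e = ?B \<union> ?C" by (auto simp: leaders_def)
  moreover have "card (b_blocks e) = card ?B"
  proof -
    have "b_blocks e = (\<lambda>i. {i, Suc i}) ` ?B" by (auto simp: b_blocks_def)
    moreover have "inj (\<lambda>i::nat. {i, Suc i})" by (auto simp: inj_def doubleton_eq_iff)
    ultimately show ?thesis by (simp add: card_image inj_on_subset)
  qed
  moreover have "card (c_blocks e) = card ?C"
  proof -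
    have "c_blocks e = (\<lambda>i. {i}) ` ?C" by (auto simp: c_blocks_def)
    moreover have "card ((\<lambda>i. {i}) ` ?C) = card ?C" by (simp add: card_image)
    ultimately show ?thesis by metis
  qed
  ultimately show ?thesis using fin by (simp add: card_Un_disjoint b_num_def c_num_def)
qed

text \<open>A leader \<open>s\<close> followed by an entry larger by one that lies outside the a-blocks would be a b-candidate.
  Either the search pairs \<open>s\<close> with that entry, which is then not a leader, or \<open>s\<close> already is the second entry of
  a b-block and not a leader itself.\<close>

lemma leaders_not_consecutive:
  assumes "sorted e" and s: "s \<in> leaders e" and t: "t \<in> leaders e"
  shows "e ! t \<noteq> e ! s + 1"
proof
  assume st: "e ! t = e ! s + 1"
  note len = leader_less_length[OF s] leader_less_length[OF t]
  note out = leader_outside_a_blocks[OF s] leader_outside_a_blocks[OF t]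
  have "s < t"
    using st sorted_nth_mono[OF \<open>sorted e\<close>, of t s] len by linarith
  \<comment> \<open>An entry strictly between positions \<open>s\<close> and \<open>t\<close> would have to repeat one of the two values.\<close>
  have "t = Suc s"
  proof (rule ccontr)
    assume "t \<noteq> Suc s"
    with \<open>s < t\<close> have k: "s < Suc s" "Suc s < t" by auto
    have "e ! s \<le> e ! Suc s" "e ! Suc s \<le> e ! t"
      using k len by (auto intro!: sorted_nth_mono[OF \<open>sorted e\<close>])
    moreover have "e ! Suc s \<noteq> e ! s" "e ! Suc s \<noteq> e ! t"
      using value_outside_a_blocks_unique[of s e "Suc s"] value_outside_a_blocks_unique[of t e "Suc s"]
        assms(1) len out k by auto
    ultimately show False using st by linarith
  qed
  with st len out have cand: "b_candidate e s" by (simp add: b_candidate_def)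
  show False
  proof (cases "b_start e s")
    case True
    with t \<open>t = Suc s\<close> show False by (auto simp: leaders_def singleton_in_c_blocks_iff)
  next
    case False
    with cand obtain r where "s = Suc r" "b_start e r" by (cases s) auto
    with s False show False by (auto simp: leaders_def singleton_in_c_blocks_iff)
  qed
qed

section \<open>Realizing exponents by integer matrices\<close>

locale prime_power_moduli =
  fixes p :: nat and d :: "nat \<Rightarrow> nat"
  assumes prime_p: "Factorial_Ring.prime p"
begin

text \<open>Elements of the direct sum of the cyclic groups of order \<open>p ^ d i\<close>, \<open>i \<in> I\<close>, are families of least
  nonnegative residues. Integer matrices describe endomorphisms; to make direct sums painless, the index set is a
  parameter and matrices are total functions.\<close>

definition coords :: "nat set \<Rightarrow> (nat \<Rightarrow> int) set" where
  "coords I = (\<Pi>\<^sub>E i\<in>I. {0..<int p ^ d i})"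

definition lin :: "nat set \<Rightarrow> (nat \<Rightarrow> nat \<Rightarrow> int) \<Rightarrow> (nat \<Rightarrow> int) \<Rightarrow> nat \<Rightarrow> int" where
  "lin I M x i = (\<Sum>j\<in>I. M i j * x j)"

text \<open>The condition under which multiplication by \<open>M\<close> is well defined on residues: the column \<open>j\<close> must be
  killed by \<open>p ^ d j\<close>.\<close>

definition compatible :: "nat set \<Rightarrow> (nat \<Rightarrow> nat \<Rightarrow> int) \<Rightarrow> bool" where
  "compatible I M \<longleftrightarrow> (\<forall>i\<in>I. \<forall>j\<in>I. int p ^ d i dvd M i j * int p ^ d j)"

text \<open>The solutions of \<open>s M x = t x\<close>. The kernel of \<open>M\<close> is the case \<open>s = 1, t = 0\<close>, the fixed points of \<open>k M\<close>
  are the case \<open>s = k, t = 1\<close>; keeping both scalars lets one computation handle both.\<close>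

definition solutions :: "nat set \<Rightarrow> (nat \<Rightarrow> nat \<Rightarrow> int) \<Rightarrow> int \<Rightarrow> int \<Rightarrow> (nat \<Rightarrow> int) set" where
  "solutions I M s t = {x \<in> coords I. \<forall>i\<in>I. int p ^ d i dvd s * lin I M x i - t * x i}"

text \<open>The matrix acts injectively, hence as an automorphism of the finite group, and the product of its
  fixed point numbers is \<open>p ^ m\<close>.\<close>

definition realizable :: "nat set \<Rightarrow> nat \<Rightarrow> bool" where
  "realizable I m \<longleftrightarrow> (\<exists>M. compatible I M \<and> card (solutions I M 1 0) = 1 \<and>
     (\<Prod>k = 1..p - 1. card (solutions I M (int k) 1)) = p ^ m)"

lemma p_gt_1: "1 < p"
  using prime_p by (rule prime_gt_1_nat)

lemma p_pos [simp]: "0 < p" "p \<noteq> 0" "p \<noteq> Suc 0"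
  using p_gt_1 by auto

lemma modulus_pos: "0 < int p ^ k"
  by simp

lemma finite_coords: "finite I \<Longrightarrow> finite (coords I)"
  unfolding coords_def by (rule finite_PiE) auto

lemma zero_in_coords: "(\<lambda>i\<in>I. 0) \<in> coords I"
  by (simp add: coords_def)

lemma coprime_modulus:
  assumes "\<not> int p dvd a"
  shows "coprime (int p ^ k) a"
proof -
  have "Factorial_Ring.prime (int p)" using prime_p by simp
  then have "coprime (int p) a" using assms prime_imp_coprime by blast
  then show ?thesis by simp
qed

lemma dvd_mult_cancel_unit: "\<not> int p dvd a \<Longrightarrow> int p ^ k dvd a * x \<longleftrightarrow> int p ^ k dvd x"
  by (rule coprime_dvd_mult_right_iff) (rule coprime_modulus)

lemma card_multiples:
  assumes "a \<le> k"
  shows "card {x \<in> {0..<int p ^ k}. int p ^ a dvd x} = p ^ (k - a)"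
proof -
  have k: "int p ^ k = int p ^ a * int p ^ (k - a)" using assms by (simp flip: power_add)
  have "{x \<in> {0..<int p ^ k}. int p ^ a dvd x} = (\<lambda>y. int p ^ a * y) ` {0..<int p ^ (k - a)}"
  proof (intro equalityI subsetI)
    fix x assume "x \<in> {x \<in> {0..<int p ^ k}. int p ^ a dvd x}"
    then obtain y where y: "x = int p ^ a * y" and "0 \<le> int p ^ a * y" "int p ^ a * y < int p ^ a * int p ^ (k - a)"
      using k by auto
    then have "0 \<le> y" "y < int p ^ (k - a)"
      using modulus_pos[of a] by (simp_all add: zero_le_mult_iff)
    with y show "x \<in> (\<lambda>y. int p ^ a * y) ` {0..<int p ^ (k - a)}" by auto
  next
    fix x assume "x \<in> (\<lambda>y. int p ^ a * y) ` {0..<int p ^ (k - a)}"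
    then show "x \<in> {x \<in> {0..<int p ^ k}. int p ^ a dvd x}"
      by (auto simp: k)
  qed
  moreover have "inj_on (\<lambda>y. int p ^ a * y) {0..<int p ^ (k - a)}"
    by (simp add: inj_on_def)
  ultimately have "card {x \<in> {0..<int p ^ k}. int p ^ a dvd x} = card {0..<int p ^ (k - a)}"
    by (simp add: card_image)
  then show ?thesis by (simp add: nat_power_eq)
qed

lemma card_coords_multiples:
  assumes "finite I" "\<And>i. i \<in> I \<Longrightarrow> a i \<le> d i"
  shows "card {x \<in> coords I. \<forall>i\<in>I. int p ^ a i dvd x i} = p ^ (\<Sum>i\<in>I. d i - a i)"
proof -
  have "{x \<in> coords I. \<forall>i\<in>I. int p ^ a i dvd x i} = (\<Pi>\<^sub>E i\<in>I. {x \<in> {0..<int p ^ d i}. int p ^ a i dvd x})"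
    by (auto simp: coords_def PiE_iff extensional_def)
  then have "card {x \<in> coords I. \<forall>i\<in>I. int p ^ a i dvd x i} =
      (\<Prod>i\<in>I. card {x \<in> {0..<int p ^ d i}. int p ^ a i dvd x})"
    using assms(1) by (simp add: card_PiE)
  also have "\<dots> = (\<Prod>i\<in>I. p ^ (d i - a i))"
    using assms(2) by (intro prod.cong refl card_multiples)
  finally show ?thesis by (simp add: power_sum)
qed

lemma coords_eq_zero:
  assumes x: "x \<in> coords I" and "\<And>i. i \<in> I \<Longrightarrow> int p ^ d i dvd x i"
  shows "x = (\<lambda>i\<in>I. 0)"
proof
  fix i
  show "x i = (\<lambda>i\<in>I. 0) i"
  proof (cases "i \<in> I")
    case True
    with x have "0 \<le> x i" "x i < int p ^ d i" by (auto simp: coords_def)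
    with assms(2)[OF True] True zdvd_imp_le[of "int p ^ d i" "x i"] show ?thesis by fastforce
  next
    case False
    with x show ?thesis by (auto simp: coords_def PiE_iff extensional_def)
  qed
qed

lemma solutionsD:
  "x \<in> solutions I M s t \<Longrightarrow> i \<in> I \<Longrightarrow> int p ^ d i dvd s * lin I M x i - t * x i"
  by (simp add: solutions_def)

lemma solutions_trivial:
  assumes "\<And>x i. x \<in> solutions I M s t \<Longrightarrow> i \<in> I \<Longrightarrow> int p ^ d i dvd x i"
  shows "card (solutions I M s t) = 1"
proof -
  have "(\<lambda>i\<in>I. 0) \<in> solutions I M s t"
    using zero_in_coords by (auto simp: solutions_def lin_def)
  moreover have "x = (\<lambda>i\<in>I. 0)" if "x \<in> solutions I M s t" for x
    using coords_eq_zero[of x I] assms[OF that] that by (auto simp: solutions_def)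
  ultimately have "solutions I M s t = {\<lambda>i\<in>I. 0}" by blast
  then show ?thesis by simp
qed

text \<open>For a matrix of the form \<open>1 + N\<close> with \<open>N\<close> nilpotent modulo \<open>p\<close>, the equation \<open>s M x = t x\<close> reads
  \<open>((s - t) + s N) x = 0\<close>, which has only the trivial solution if \<open>s - t\<close> is a unit modulo \<open>p\<close>. This covers
  injectivity and all multipliers \<open>k \<noteq> 1\<close> at once, so only the kernel of \<open>N\<close> contributes.\<close>

lemma realizable_unipotentI:
  assumes "compatible I M"
    and "\<And>s t x i. \<not> int p dvd s - t \<Longrightarrow> x \<in> solutions I M s t \<Longrightarrow> i \<in> I \<Longrightarrow> int p ^ d i dvd x i"
    and "card (solutions I M 1 1) = p ^ m"
  shows "realizable I m"
proof -
  have unit: "card (solutions I M s t) = 1" if "\<not> int p dvd s - t" for s t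
    using assms(2)[OF that] by (rule solutions_trivial)
  have "card (solutions I M (int k) 1) = 1" if "k \<in> {1..p - 1} - {1}" for k
  proof -
    have "0 < int k - 1" "int k - 1 < int p" using that by auto
    then show ?thesis by (intro unit) (use zdvd_not_zless in auto)
  qed
  then have "(\<Prod>k\<in>{1..p - 1} - {1}. card (solutions I M (int k) 1)) = 1"
    by simp
  moreover have "1 \<in> {1..p - 1}" using p_gt_1 by auto
  ultimately have "(\<Prod>k = 1..p - 1. card (solutions I M (int k) 1)) = p ^ m"
    using prod.remove[of "{1..p - 1}" 1 "\<lambda>k. card (solutions I M (int k) 1)"] assms(3) by simp
  moreover have "card (solutions I M 1 0) = 1" using p_gt_1 by (intro unit) auto
  ultimately show ?thesis using assms(1) unfolding realizable_def by blast
qed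

lemma realizable_singleton:
  assumes "1 \<le> m" "m \<le> d i"
  shows "realizable {i} m"
proof (rule realizable_unipotentI[where M = "\<lambda>_ _. 1 + int p ^ m"])
  let ?M = "\<lambda>_ _. 1 + int p ^ m"
  show "compatible {i} ?M" by (simp add: compatible_def)
  show "int p ^ d j dvd x j"
    if st: "\<not> int p dvd s - t" and x: "x \<in> solutions {i} ?M s t" and j: "j \<in> {i}" for s t x j
  proof -
    have "int p ^ d i dvd ((s - t) + int p ^ m * s) * x i"
      using x by (simp add: solutions_def lin_def algebra_simps)
    moreover have "\<not> int p dvd (s - t) + int p ^ m * s"
      using st assms(1) by (subst dvd_add_left_iff) auto
    ultimately show ?thesis using j dvd_mult_cancel_unit by simp
  qed
  have "int p ^ d i dvd 1 * ((1 + int p ^ m) * y) - 1 * y \<longleftrightarrow> int p ^ (d i - m) dvd y" for y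
  proof -
    have "int p ^ d i = int p ^ m * int p ^ (d i - m)" using assms by (simp flip: power_add)
    then show ?thesis using p_gt_1 by (simp add: algebra_simps)
  qed
  then have "solutions {i} ?M 1 1 = {x \<in> coords {i}. \<forall>j\<in>{i}. int p ^ (d j - m) dvd x j}"
    by (simp add: solutions_def lin_def)
  then show "card (solutions {i} ?M 1 1) = p ^ m"
    using card_coords_multiples[of "{i}" "\<lambda>j. d j - m"] assms by simp
qed

text \<open>The matrix is \<open>1 + N\<close>, where \<open>N\<close> sends the \<open>j\<close>-th generator to the \<open>i\<close>-th one and the \<open>i\<close>-th one to \<open>p\<close>
  times the \<open>j\<close>-th one. Its square is multiplication by \<open>p\<close>, and its kernel has order \<open>p\<close> only, whereas
  for a diagonal matrix the product of the fixed point numbers is at least \<open>p\<^sup>2\<close>.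
  The second case of the hypothesis is a b-block, the first one a pair of equal exponents.\<close>

lemma realizable_pair:
  assumes "i \<noteq> j" "d j = d i \<or> d j = Suc (d i)" "1 \<le> d i"
  shows "realizable {i, j} 1"
proof -
  define M :: "nat \<Rightarrow> nat \<Rightarrow> int" where "M = (\<lambda>k l. if k = j \<and> l = i then int p else 1)"
  have lin: "lin {i, j} M x i = x i + x j" "lin {i, j} M x j = int p * x i + x j" for x
    using assms(1) by (auto simp: lin_def M_def)
  have ij: "int p ^ d i dvd int p ^ d j" "int p ^ d j dvd int p * int p ^ d i"
    using assms(2) by (auto simp: le_imp_power_dvd)
  show ?thesis
  proof (rule realizable_unipotentI[where M = M])
    show "compatible {i, j} M" using ij by (auto simp: compatible_def M_def)
    show "int p ^ d k dvd x k"
      if st: "\<not> int p dvd s - t" and x: "x \<in> solutions {i, j} M s t" and k: "k \<in> {i, j}" for s t x k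
    proof -
      from x have eqs: "int p ^ d i dvd s * (x i + x j) - t * x i"
        "int p ^ d j dvd s * (int p * x i + x j) - t * x j"
        by (auto simp: solutions_def lin)
      \<comment> \<open>Eliminating \<open>x i\<close> leaves \<open>x j\<close> times the determinant, which is a unit modulo \<open>p\<close>.\<close>
      have *: "int p ^ d j dvd int p * (s * (x i + x j) - t * x i)"
        by (rule dvd_trans[OF ij(2)]) (rule mult_dvd_mono[OF dvd_refl eqs(1)])
      have "int p ^ d j dvd (s - t) * (s * (int p * x i + x j) - t * x j)
          - s * (int p * (s * (x i + x j) - t * x i))"
        by (rule dvd_diff) (rule dvd_mult[OF eqs(2)], rule dvd_mult[OF *])
      also have "\<dots> = ((s - t)\<^sup>2 - int p * s\<^sup>2) * x j"
        by (simp add: algebra_simps power2_eq_square)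
      finally have "int p ^ d j dvd ((s - t)\<^sup>2 - int p * s\<^sup>2) * x j" .
      moreover have "\<not> int p dvd (s - t)\<^sup>2 - int p * s\<^sup>2"
      proof
        assume "int p dvd (s - t)\<^sup>2 - int p * s\<^sup>2"
        then have "int p dvd (s - t)\<^sup>2" by (metis dvd_add_triv_right_iff diff_add_cancel dvd_triv_left dvd_add)
        with prime_p st show False by (metis prime_dvd_power prime_nat_int_transfer)
      qed
      ultimately have j: "int p ^ d j dvd x j" using dvd_mult_cancel_unit by blast
      then have "int p ^ d i dvd x j" using ij(1) dvd_trans by blast
      then have "int p ^ d i dvd (s * (x i + x j) - t * x i) - s * x j"
        by (rule dvd_diff[OF eqs(1) dvd_mult])
      also have "\<dots> = (s - t) * x i" by (simp add: algebra_simps)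
      finally have "int p ^ d i dvd x i" using st dvd_mult_cancel_unit by blast
      with j k show ?thesis by blast
    qed
    define a where "a = (\<lambda>k. if k = i then d j - 1 else d i)"
    have "int p ^ d j = int p * int p ^ (d j - 1)"
      using assms by (cases "d j") auto
    then have pj: "int p ^ d j dvd int p * y \<longleftrightarrow> int p ^ (d j - 1) dvd y" for y
      using p_gt_1 by simp
    have "solutions {i, j} M 1 1 = {x \<in> coords {i, j}. \<forall>k\<in>{i, j}. int p ^ a k dvd x k}"
      using assms(1) by (auto simp: solutions_def lin a_def pj)
    moreover have "(\<Sum>k\<in>{i, j}. d k - a k) = 1" using assms by (auto simp: a_def)
    moreover have "a k \<le> d k" if "k \<in> {i, j}" for k using assms that by (auto simp: a_def)
    ultimately show "card (solutions {i, j} M 1 1) = p ^ 1"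
      using card_coords_multiples[of "{i, j}" a] by simp
  qed
qed

text \<open>Each of the \<open>p - 1\<close> values of \<open>s\<close> excludes one residue class of \<open>c\<close>, so one of the \<open>p\<close> classes survives.\<close>

lemma ex_rootless_trinomial: "\<exists>c. \<forall>s\<in>{1..int p - 1}. \<not> int p dvd c * s ^ r + s - 1"
proof (rule ccontr)
  assume "\<not> ?thesis"
  then have "\<forall>c. \<exists>s. s \<in> {1..int p - 1} \<and> int p dvd c * s ^ r + s - 1" by blast
  then obtain f where f: "\<And>c. f c \<in> {1..int p - 1}" "\<And>c. int p dvd c * f c ^ r + f c - 1"
    by metis
  have "inj_on f {0..<int p}"
  proof
    fix c c' assume c: "c \<in> {0..<int p}" "c' \<in> {0..<int p}" "f c = f c'"
    have "int p dvd (c * f c ^ r + f c - 1) - (c' * f c' ^ r + f c' - 1)" by (rule dvd_diff[OF f(2) f(2)])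
    also have "\<dots> = f c ^ r * (c - c')" using c(3) by (simp add: algebra_simps)
    finally have *: "int p ^ 1 dvd f c ^ r * (c - c')" by simp
    have "\<not> int p dvd f c" using f(1)[of c] zdvd_not_zless by auto
    then have "\<not> int p dvd f c ^ r" using prime_p by (metis prime_dvd_power prime_nat_int_transfer)
    with * have "int p dvd c - c'" using dvd_mult_cancel_unit[of _ 1] by simp
    moreover have "\<bar>c - c'\<bar> < int p" using c by auto
    ultimately have "c - c' = 0" using dvd_imp_le_int[of "c - c'" "int p"] by auto
    then show "c = c'" by simp
  qed
  moreover have "f ` {0..<int p} \<subseteq> {1..int p - 1}" using f(1) by auto
  ultimately have "card {0..<int p} \<le> card {1..int p - 1}" by (rule card_inj_on_le) simp
  then show False using p_gt_1 by simp
qed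

text \<open>The companion matrix of \<open>X ^ r - X ^ (r - 1) - c\<close>, where \<open>r = b - a\<close>. An eigenvector for the eigenvalue
  \<open>1 / s\<close> is determined by its last coordinate, which is killed by \<open>c s ^ r + s - 1\<close>; by the choice of \<open>c\<close>
  this is a unit for all \<open>s = 1, \<dots>, p - 1\<close>. The case \<open>s = 1\<close> says that \<open>c\<close> is a unit, which makes the
  matrix invertible as soon as \<open>r \<ge> 2\<close>.\<close>

lemma realizable_constant_zero:
  assumes ab: "a + 2 \<le> b" and const: "\<And>i. i \<in> {a..<b} \<Longrightarrow> d i = k"
  shows "realizable {a..<b} 0"
proof -
  obtain c where c: "\<And>s. s \<in> {1..int p - 1} \<Longrightarrow> \<not> int p dvd c * s ^ (b - a) + s - 1"
    using ex_rootless_trinomial by blast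
  have c_unit: "\<not> int p dvd c" using c[of 1] p_gt_1 by simp
  define M :: "nat \<Rightarrow> nat \<Rightarrow> int" where
    "M = (\<lambda>i j. if Suc i < b then (if j = Suc i then 1 else 0)
                else (if j = a then c else 0) + (if j = b - 1 then 1 else 0))"
  have lin_shift: "lin {a..<b} M x i = x (Suc i)" if "a \<le> i" "Suc i < b" for x i
    using that by (simp add: lin_def M_def if_distrib[of "\<lambda>y. y * _"] sum.delta cong: if_cong)
  have lin_last: "lin {a..<b} M x (b - 1) = c * x a + x (b - 1)" for x
    using ab by (simp add: lin_def M_def distrib_right sum.distrib if_distrib[of "\<lambda>y. y * _"] sum.delta cong: if_cong)
  have shift: "int p ^ k dvd s * x (Suc i) - t * x i" if "x \<in> solutions {a..<b} M s t" "a \<le> i" "Suc i < b" for x s t i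
  proof -
    have "i \<in> {a..<b}" using that by simp
    from solutionsD[OF that(1) this] show ?thesis by (simp add: lin_shift that const[OF \<open>i \<in> {a..<b}\<close>])
  qed
  have last: "int p ^ k dvd s * (c * x a + x (b - 1)) - t * x (b - 1)" if "x \<in> solutions {a..<b} M s t" for x s t
  proof -
    have "b - 1 \<in> {a..<b}" using ab by simp
    from solutionsD[OF that this] show ?thesis unfolding lin_last const[OF \<open>b - 1 \<in> {a..<b}\<close>] .
  qed
  have "compatible {a..<b} M" using const by (auto simp: compatible_def)
  moreover have "card (solutions {a..<b} M 1 0) = 1"
  proof (rule solutions_trivial)
    fix x i assume x: "x \<in> solutions {a..<b} M 1 0" and i: "i \<in> {a..<b}"
    have later: "int p ^ k dvd x j" if "a < j" "j < b" for j
      using shift[OF x, of "j - 1"] that by simp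
    then have "int p ^ k dvd (c * x a + x (b - 1)) - x (b - 1)"
      using last[OF x] later[of "b - 1"] ab by (intro dvd_diff) auto
    then have "int p ^ k dvd x a" using dvd_mult_cancel_unit[OF c_unit] by simp
    with later i const[OF i] show "int p ^ d i dvd x i" by (cases "i = a") auto
  qed
  moreover have "card (solutions {a..<b} M (int s) 1) = 1" if s: "s \<in> {1..p - 1}" for s
  proof (rule solutions_trivial)
    fix x i assume x: "x \<in> solutions {a..<b} M (int s) 1" and i: "i \<in> {a..<b}"
    \<comment> \<open>Walking back from the last coordinate multiplies by \<open>s\<close> at each step.\<close>
    have geom: "int p ^ k dvd int s ^ l * x (b - 1) - x (b - 1 - l)" if "a + l < b" for l
      using that
    proof (induction l)
      case (Suc l)
      have "int p ^ k dvd int s * (int s ^ l * x (b - 1) - x (b - 1 - l))"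
        using Suc by (intro dvd_mult) auto
      moreover have "Suc (b - 1 - Suc l) = b - 1 - l" using Suc.prems by linarith
      then have "int p ^ k dvd int s * x (b - 1 - l) - 1 * x (b - 1 - Suc l)"
        using shift[OF x, of "b - 1 - Suc l"] Suc.prems by simp
      ultimately have "int p ^ k dvd int s * (int s ^ l * x (b - 1) - x (b - 1 - l))
          + (int s * x (b - 1 - l) - 1 * x (b - 1 - Suc l))" by (rule dvd_add)
      then show ?case by (simp add: algebra_simps)
    qed simp
    \<comment> \<open>Substituting the formula for \<open>x a\<close> into the last row closes the cycle.\<close>
    have "int p ^ k dvd int s * c * (int s ^ (b - 1 - a) * x (b - 1) - x a)"
      using geom[of "b - 1 - a"] ab by (intro dvd_mult) auto
    then have "int p ^ k dvd int s * c * (int s ^ (b - 1 - a) * x (b - 1) - x a)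
        + (int s * (c * x a + x (b - 1)) - 1 * x (b - 1))"
      using last[OF x] by (rule dvd_add)
    also have "\<dots> = (c * (int s * int s ^ (b - 1 - a)) + int s - 1) * x (b - 1)"
      by (simp add: algebra_simps)
    also have "int s * int s ^ (b - 1 - a) = int s ^ (b - a)"
    proof -
      have "b - a = Suc (b - 1 - a)" using ab by linarith
      then show ?thesis by simp
    qed
    finally have "int p ^ k dvd x (b - 1)"
      using c[of "int s"] s p_gt_1 dvd_mult_cancel_unit by auto
    then have "int p ^ k dvd int s ^ (b - 1 - i) * x (b - 1)" by simp
    moreover have "a + (b - 1 - i) < b" "b - 1 - (b - 1 - i) = i" using i by auto
    then have "int p ^ k dvd int s ^ (b - 1 - i) * x (b - 1) - x i"
      using geom[of "b - 1 - i"] by simp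
    ultimately have "int p ^ k dvd int s ^ (b - 1 - i) * x (b - 1) - (int s ^ (b - 1 - i) * x (b - 1) - x i)"
      by (rule dvd_diff)
    then show "int p ^ d i dvd x i" using i const[OF i] by simp
  qed
  ultimately show ?thesis unfolding realizable_def by auto
qed

lemma card_solutions_block_sum:
  fixes A B :: "nat \<Rightarrow> nat \<Rightarrow> int"
  assumes "finite I" "finite J" "I \<inter> J = {}"
  defines "M \<equiv> \<lambda>i j. if i \<in> I \<and> j \<in> I then A i j else if i \<in> J \<and> j \<in> J then B i j else 0"
  shows "card (solutions (I \<union> J) M s t) = card (solutions I A s t) * card (solutions J B s t)"
proof -
  have linI: "lin (I \<union> J) M x i = lin I A x i" if "i \<in> I" for x i
  proof -
    have "lin (I \<union> J) M x i = (\<Sum>j\<in>I. M i j * x j)"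
      unfolding lin_def using assms that by (intro sum.mono_neutral_right) auto
    then show ?thesis using that by (simp add: lin_def M_def)
  qed
  have linJ: "lin (I \<union> J) M x i = lin J B x i" if "i \<in> J" for x i
  proof -
    have "lin (I \<union> J) M x i = (\<Sum>j\<in>J. M i j * x j)"
      unfolding lin_def using assms that by (intro sum.mono_neutral_right) auto
    then show ?thesis using that assms(3) by (auto simp: lin_def M_def intro!: sum.cong)
  qed
  have cong: "lin K C x i = lin K C y i" if "\<And>j. j \<in> K \<Longrightarrow> x j = y j" for K C x y i
    using that by (simp add: lin_def)
  have "bij_betw (\<lambda>x. (restrict x I, restrict x J)) (solutions (I \<union> J) M s t)
      (solutions I A s t \<times> solutions J B s t)"
  proof (rule bij_betw_byWitness[where f' = "\<lambda>(y, z) i. if i \<in> I then y i else z i"])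
    show "\<forall>x\<in>solutions (I \<union> J) M s t.
        (case (restrict x I, restrict x J) of (y, z) \<Rightarrow> \<lambda>i. if i \<in> I then y i else z i) = x"
      by (auto simp: solutions_def coords_def fun_eq_iff PiE_iff extensional_def)
    show "\<forall>yz\<in>solutions I A s t \<times> solutions J B s t.
        (restrict (case yz of (y, z) \<Rightarrow> \<lambda>i. if i \<in> I then y i else z i) I,
         restrict (case yz of (y, z) \<Rightarrow> \<lambda>i. if i \<in> I then y i else z i) J) = yz"
      using assms(3) by (auto simp: solutions_def coords_def fun_eq_iff PiE_iff extensional_def)
    show "(\<lambda>x. (restrict x I, restrict x J)) ` solutions (I \<union> J) M s t
        \<subseteq> solutions I A s t \<times> solutions J B s t"
    proof clarify
      fix x assume x: "x \<in> solutions (I \<union> J) M s t"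
      have "lin I A (restrict x I) i = lin I A x i" "lin J B (restrict x J) i = lin J B x i" for i
        by (auto intro!: cong)
      with x show "restrict x I \<in> solutions I A s t \<and> restrict x J \<in> solutions J B s t"
        by (auto simp: solutions_def coords_def linI linJ PiE_iff ball_Un)
    qed
    show "(\<lambda>(y, z) i. if i \<in> I then y i else z i) ` (solutions I A s t \<times> solutions J B s t)
        \<subseteq> solutions (I \<union> J) M s t"
    proof clarify
      fix y z assume y: "y \<in> solutions I A s t" and z: "z \<in> solutions J B s t"
      let ?x = "\<lambda>i. if i \<in> I then y i else z i"
      have "lin I A ?x i = lin I A y i" "lin J B ?x i = lin J B z i" for i
        using assms(3) by (auto intro!: cong)
      with y z assms(3) show "?x \<in> solutions (I \<union> J) M s t"
        by (auto simp: solutions_def coords_def linI linJ PiE_iff extensional_def)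
    qed
  qed
  from bij_betw_same_card[OF this] show ?thesis by (simp only: card_cartesian_product)
qed

lemma realizable_Un:
  assumes "finite I" "finite J" "I \<inter> J = {}" "realizable I m" "realizable J n"
  shows "realizable (I \<union> J) (m + n)"
proof -
  from assms(4,5) obtain A B where A: "compatible I A" "card (solutions I A 1 0) = 1"
      "(\<Prod>k = 1..p - 1. card (solutions I A (int k) 1)) = p ^ m"
    and B: "compatible J B" "card (solutions J B 1 0) = 1"
      "(\<Prod>k = 1..p - 1. card (solutions J B (int k) 1)) = p ^ n"
    unfolding realizable_def by blast
  define M where "M = (\<lambda>i j. if i \<in> I \<and> j \<in> I then A i j else if i \<in> J \<and> j \<in> J then B i j else 0)"
  have "compatible (I \<union> J) M" using A(1) B(1) by (auto simp: compatible_def M_def)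
  moreover have "card (solutions (I \<union> J) M s t) = card (solutions I A s t) * card (solutions J B s t)" for s t
    unfolding M_def by (rule card_solutions_block_sum) fact+
  ultimately show ?thesis
    using A B unfolding realizable_def by (intro exI[of _ M]) (simp add: prod.distrib power_add)
qed

lemma realizable_empty: "realizable {} 0"
  by (simp add: realizable_def compatible_def solutions_def coords_def)

lemma nat_interval_sum_split:
  fixes m :: nat
  assumes "a \<le> b" "c \<le> e" "a + c \<le> m" "m \<le> b + e"
  obtains m1 m2 where "m = m1 + m2" "a \<le> m1" "m1 \<le> b" "c \<le> m2" "m2 \<le> e"
proof (cases "m \<le> b + c")
  case True
  then show ?thesis using assms by (intro that[of "m - c" c]) auto
next
  case False
  then show ?thesis using assms by (intro that[of b "m - b"]) auto
qed

lemma realizable_disjoint_Union: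
  assumes "finite F" "pairwise disjnt F"
    and "\<And>B. B \<in> F \<Longrightarrow> finite B" "\<And>B. B \<in> F \<Longrightarrow> lo B \<le> hi B"
    and "\<And>B m. B \<in> F \<Longrightarrow> lo B \<le> m \<Longrightarrow> m \<le> hi B \<Longrightarrow> realizable B m"
    and "sum lo F \<le> m" "m \<le> sum hi F"
  shows "realizable (\<Union>F) m"
  using assms
proof (induction F arbitrary: m rule: finite_induct)
  case empty
  then show ?case using realizable_empty by simp
next
  case (insert B F)
  have "sum lo F \<le> sum hi F" using insert.prems(3) by (intro sum_mono) auto
  then obtain m1 m2 where m: "m = m1 + m2" "lo B \<le> m1" "m1 \<le> hi B" "sum lo F \<le> m2" "m2 \<le> sum hi F"
    using nat_interval_sum_split[of "lo B" "hi B" "sum lo F" "sum hi F" m] insert by auto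
  have "realizable (\<Union>F) m2"
    using insert.prems m by (intro insert.IH) (auto simp: pairwise_insert)
  moreover have "realizable B m1" using insert.prems m by auto
  moreover have "B \<inter> \<Union>F = {}"
    using insert.prems(1) insert.hyps(2) by (auto simp: pairwise_insert disjnt_def)
  moreover have "finite B" "finite (\<Union>F)" using insert by auto
  ultimately show ?case using realizable_Un[of B "\<Union>F"] m(1) by simp
qed

text \<open>Adding one position of exponent \<open>k\<close> shifts the realized interval by each of \<open>1, \<dots>, k\<close>, which reaches
  everything except \<open>0\<close>; the companion matrix supplies \<open>0\<close>. In length two, \<open>1\<close> is missing as well and comes
  from \<open>realizable_pair\<close>.\<close>

lemma realizable_constant:
  assumes "a + 2 \<le> b" "\<And>i. i \<in> {a..<b} \<Longrightarrow> d i = k" "1 \<le> k" "m \<le> (b - a) * k"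
  shows "realizable {a..<b} m"
  using assms
proof (induction b arbitrary: m rule: dec_induct[of "a + 2", consumes 1, case_names base step])
  case base
  have set: "{a..<a + 2} = {a, Suc a}" by auto
  have d: "d a = k" "d (Suc a) = k" using base by auto
  consider "m = 0" | "m = 1" | "2 \<le> m" by linarith
  then show ?case
  proof cases
    case 1
    then show ?thesis using realizable_constant_zero[of a "a + 2" k] base by simp
  next
    case 2
    then show ?thesis using realizable_pair[of a "Suc a"] base d set by simp
  next
    case 3
    have "m \<le> k + k" using base.prems(3) by simp
    with 3 obtain m1 m2 where "m = m1 + m2" "1 \<le> m1" "m1 \<le> k" "1 \<le> m2" "m2 \<le> k"
      using nat_interval_sum_split[of 1 k 1 k m] base by auto
    then show ?thesis
      using realizable_Un[OF _ _ _ realizable_singleton[of m1 a] realizable_singleton[of m2 "Suc a"]] d set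
      by (simp add: insert_commute)
  qed
next
  case (step b)
  have set: "{a..<Suc b} = {a..<b} \<union> {b}" using step.hyps by auto
  show ?case
  proof (cases "m = 0")
    case True
    then show ?thesis using realizable_constant_zero[of a "Suc b" k] step by simp
  next
    case False
    have "m \<le> (b - a) * k + k" using step.prems(3) step.hyps by (simp add: Suc_diff_le)
    with False obtain m1 m2 where m: "m = m1 + m2" "m1 \<le> (b - a) * k" "1 \<le> m2" "m2 \<le> k"
      using nat_interval_sum_split[of 0 "(b - a) * k" 1 k m] step by auto
    have "realizable {a..<b} m1" using step m by auto
    moreover have "realizable {b} m2" using m step by (intro realizable_singleton) auto
    ultimately show ?thesis using realizable_Un[of "{a..<b}" "{b}"] set m(1) by simp
  qed
qed

lemma realizable_consecutive:
  assumes "d (Suc i) = d i + 1" "1 \<le> d i" "1 \<le> m" "m \<le> d i + d (Suc i)"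
  shows "realizable {i, Suc i} m"
proof (cases "m = 1")
  case True
  then show ?thesis using realizable_pair[of i "Suc i"] assms by simp
next
  case False
  then obtain m1 m2 where "m = m1 + m2" "1 \<le> m1" "m1 \<le> d i" "1 \<le> m2" "m2 \<le> d (Suc i)"
    using nat_interval_sum_split[of 1 "d i" 1 "d (Suc i)" m] assms by auto
  then show ?thesis
    using realizable_Un[OF _ _ _ realizable_singleton[of m1 i] realizable_singleton[of m2 "Suc i"]]
    by (simp add: insert_commute)
qed

end

text \<open>The blocks partition the positions; an a-block realizes every exponent from \<open>0\<close> to the sum of its
  entries, the other blocks every exponent from \<open>1\<close> on.\<close>

lemma realizable_between_block_count_and_sum:
  assumes "Factorial_Ring.prime p" "\<forall>k\<in>set e. 1 \<le> k"
    and m: "b_num e + c_num e \<le> m" "m \<le> sum_list e"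
  shows "prime_power_moduli.realizable p (\<lambda>i. e ! i) {..<length e} m"
proof -
  interpret prime_power_moduli p "\<lambda>i. e ! i" by unfold_locales fact
  let ?F = "a_blocks e \<union> b_blocks e \<union> c_blocks e"
  define lo :: "nat set \<Rightarrow> nat" where "lo B = (if B \<in> a_blocks e then 0 else 1)" for B
  define hi where "hi B = (\<Sum>i\<in>B. e ! i)" for B
  have sub: "B \<subseteq> {..<length e}" if "B \<in> ?F" for B using blocks_cover that by blast
  have pos: "1 \<le> e ! i" if "B \<in> ?F" "i \<in> B" for B i using sub that assms(2) by fastforce
  have finB: "finite B" if "B \<in> ?F" for B using sub[OF that] finite_subset by blast
  have finF: "finite ?F" using sub by (intro finite_subset[of ?F "Pow {..<length e}"]) auto
  have block: "lo B \<le> hi B \<and> (\<forall>m. lo B \<le> m \<longrightarrow> m \<le> hi B \<longrightarrow> realizable B m)" if B: "B \<in> ?F" for B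
  proof -
    consider "B \<in> a_blocks e" | "B \<notin> a_blocks e" "B \<in> b_blocks e" | "B \<notin> a_blocks e" "B \<in> c_blocks e"
      using B by blast
    then show ?thesis
    proof cases
      case 1
      then obtain i j where ij: "B = {i..<j}" "i + 2 \<le> j" and const: "\<And>k. k \<in> B \<Longrightarrow> e ! k = e ! i"
        using a_block_interval by blast
      have "hi B = (\<Sum>k\<in>B. e ! i)" unfolding hi_def using const by (rule sum.cong[OF refl])
      then have "hi B = (j - i) * e ! i" using ij by simp
      moreover have "1 \<le> e ! i" using pos[OF B] ij by simp
      ultimately show ?thesis
        using 1 ij realizable_constant[OF ij(2) const] by (simp add: lo_def)
    next
      case 2
      then obtain i where i: "B = {i, Suc i}" "b_start e i" by (auto simp: b_blocks_def)
      then have "e ! Suc i = e ! i + 1" using b_start_candidate by (auto simp: b_candidate_def)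
      moreover have "1 \<le> e ! i" using pos[OF B] i by simp
      ultimately show ?thesis
        using 2 i realizable_consecutive[of i] by (auto simp: lo_def hi_def)
    next
      case 3
      then obtain i where i: "B = {i}" by (auto simp: c_blocks_def)
      moreover have "1 \<le> e ! i" using pos[OF B] i by simp
      ultimately show ?thesis
        using 3 realizable_singleton[of _ i] by (auto simp: lo_def hi_def)
    qed
  qed
  have ne: "B \<noteq> {}" if "B \<in> ?F" for B
    using that by (auto simp: a_blocks_def b_blocks_def c_blocks_def)
  have "B \<notin> a_blocks e" if "B \<in> b_blocks e" for B
  proof -
    from that obtain i where "B = {i, Suc i}" "b_start e i" by (auto simp: b_blocks_def)
    then show ?thesis using b_start_candidate[of e i] by (auto simp: b_candidate_def)
  qed
  moreover have "B \<notin> a_blocks e \<union> b_blocks e" if "B \<in> c_blocks e" for B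
    using that by (auto simp: a_blocks_def b_blocks_def c_blocks_def)
  ultimately have ab: "a_blocks e \<inter> (b_blocks e \<union> c_blocks e) = {}" and bc: "b_blocks e \<inter> c_blocks e = {}"
    by blast+
  have "sum lo ?F = sum lo (a_blocks e) + sum lo (b_blocks e \<union> c_blocks e)"
    using sum.union_disjoint[of "a_blocks e" "b_blocks e \<union> c_blocks e" lo] finF ab by (simp add: Un_assoc)
  also have "sum lo (a_blocks e) = 0" by (simp add: lo_def)
  also have "sum lo (b_blocks e \<union> c_blocks e) = (\<Sum>B\<in>b_blocks e \<union> c_blocks e. 1)"
    using ab by (intro sum.cong) (auto simp: lo_def)
  also have "\<dots> = b_num e + c_num e"
    using finF bc by (simp add: card_Un_disjoint b_num_def c_num_def)
  finally have "sum lo ?F = b_num e + c_num e" by simp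
  moreover have "sum hi ?F = sum_list e"
  proof -
    have "sum hi ?F = (\<Sum>i\<in>\<Union>?F. e ! i)"
      unfolding hi_def using finB blocks_disjoint
      by (subst sum.Union_disjoint) (auto simp: pairwise_def disjnt_def)
    then show ?thesis by (simp only: blocks_cover) (simp add: sum_list_sum_nth atLeast0LessThan)
  qed
  ultimately have "realizable (\<Union>?F) m"
    using m finF finB blocks_disjoint block by (intro realizable_disjoint_Union[where lo = lo and hi = hi]) auto
  then show ?thesis by (simp only: blocks_cover)
qed

section \<open>Fixed points of powers of an automorphism\<close>

lemma Fix_compose_mu:
  assumes "\<phi> \<in> carrier G \<rightarrow> carrier G"
  shows "Fix G (compose (carrier G) (mu G i) \<phi>) = {x \<in> carrier G. \<phi> x [^]\<^bsub>G\<^esub> i = x}"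
  using assms by (auto simp: Fix_def compose_def mu_def)

lemma auto_hom: "\<phi> \<in> auto G \<Longrightarrow> \<phi> \<in> hom G G"
  by (simp add: auto_def)

lemma Pi_fix_eq:
  assumes "\<phi> \<in> auto G"
  shows "Pi_fix p G \<phi> = (\<Prod>i = 1..p - 1. card {x \<in> carrier G. \<phi> x [^]\<^bsub>G\<^esub> int i = x})"
proof -
  have "\<phi> \<in> carrier G \<rightarrow> carrier G" using auto_hom[OF assms] by (auto simp: hom_def)
  then show ?thesis by (simp add: Pi_fix_def Fix_compose_mu)
qed

text \<open>Conjugation by an isomorphism matches automorphisms, and it commutes with taking powers.\<close>

lemma Spec_Pi_iso_subset:
  assumes "group G" "group H" and h: "h \<in> iso G H"
  shows "Spec_Pi p G \<subseteq> Spec_Pi p H"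
proof
  fix n assume "n \<in> Spec_Pi p G"
  then obtain \<psi> where \<psi>: "\<psi> \<in> auto G" and n: "n = Pi_fix p G \<psi>" by (auto simp: Spec_Pi_def)
  interpret G: group G by fact
  interpret H: group H by fact
  define g where "g = inv_into (carrier G) h"
  have g: "g \<in> iso H G" unfolding g_def by (rule G.iso_set_sym[OF h])
  have bij: "bij_betw h (carrier G) (carrier H)" "bij_betw \<psi> (carrier G) (carrier G)"
      "bij_betw g (carrier H) (carrier G)"
    using h g \<psi> by (auto simp: iso_def auto_def Bij_def)
  have gh: "g (h x) = x" if "x \<in> carrier G" for x
    using that bij(1) by (simp add: g_def bij_betw_def)
  have hg: "h (g y) = y" if "y \<in> carrier H" for y
    using that bij(1) by (simp add: g_def bij_betw_def f_inv_into_f)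
  have closed: "h x \<in> carrier H" "\<psi> x \<in> carrier G" if "x \<in> carrier G" for x
    using that bij by (auto simp: bij_betw_def)
  have gclosed: "g y \<in> carrier G" if "y \<in> carrier H" for y
    using that bij by (auto simp: bij_betw_def)
  define \<psi>' where "\<psi>' = (\<lambda>y\<in>carrier H. h (\<psi> (g y)))"
  have "bij_betw (h \<circ> (\<psi> \<circ> g)) (carrier H) (carrier H)"
    using bij by (intro bij_betw_trans)
  then have "bij_betw \<psi>' (carrier H) (carrier H)"
    by (subst bij_betw_cong[where g = "h \<circ> (\<psi> \<circ> g)"]) (auto simp: \<psi>'_def)
  moreover have "\<psi>' \<in> hom H H"
  proof (rule homI)
    fix x y assume xy: "x \<in> carrier H" "y \<in> carrier H"
    have "g (x \<otimes>\<^bsub>H\<^esub> y) = g x \<otimes>\<^bsub>G\<^esub> g y" using g xy by (auto simp: iso_def hom_def)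
    moreover have "\<psi> (g x \<otimes>\<^bsub>G\<^esub> g y) = \<psi> (g x) \<otimes>\<^bsub>G\<^esub> \<psi> (g y)"
      using auto_hom[OF \<psi>] gclosed xy by (auto simp: hom_def)
    moreover have "h (\<psi> (g x) \<otimes>\<^bsub>G\<^esub> \<psi> (g y)) = h (\<psi> (g x)) \<otimes>\<^bsub>H\<^esub> h (\<psi> (g y))"
      using h closed gclosed xy by (auto simp: iso_def hom_def)
    ultimately show "\<psi>' (x \<otimes>\<^bsub>H\<^esub> y) = \<psi>' x \<otimes>\<^bsub>H\<^esub> \<psi>' y" using xy by (simp add: \<psi>'_def)
  qed (simp add: \<psi>'_def closed gclosed)
  ultimately have auto': "\<psi>' \<in> auto H" by (simp add: auto_def Bij_def \<psi>'_def)
  have "card {x \<in> carrier G. \<psi> x [^]\<^bsub>G\<^esub> i = x} = card {y \<in> carrier H. \<psi>' y [^]\<^bsub>H\<^esub> i = y}" for i :: int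
  proof -
    have pow: "h (x [^]\<^bsub>G\<^esub> i) = h x [^]\<^bsub>H\<^esub> i" if "x \<in> carrier G" for x
      using h that by (intro hom_int_pow) (auto simp: iso_def G.is_group H.is_group)
    have fix_iff: "\<psi>' (h x) [^]\<^bsub>H\<^esub> i = h x \<longleftrightarrow> \<psi> x [^]\<^bsub>G\<^esub> i = x" if x: "x \<in> carrier G" for x
    proof -
      have "\<psi>' (h x) [^]\<^bsub>H\<^esub> i = h (\<psi> x [^]\<^bsub>G\<^esub> i)" using x closed by (simp add: \<psi>'_def gh pow)
      then show ?thesis using x closed bij(1) by (metis G.int_pow_closed gh)
    qed
    have "{y \<in> carrier H. \<psi>' y [^]\<^bsub>H\<^esub> i = y} = h ` {x \<in> carrier G. \<psi> x [^]\<^bsub>G\<^esub> i = x}"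
    proof (intro equalityI subsetI)
      fix y assume y: "y \<in> {y \<in> carrier H. \<psi>' y [^]\<^bsub>H\<^esub> i = y}"
      then have "\<psi> (g y) [^]\<^bsub>G\<^esub> i = g y" using fix_iff[of "g y"] gclosed hg by simp
      then show "y \<in> h ` {x \<in> carrier G. \<psi> x [^]\<^bsub>G\<^esub> i = x}"
        using y gclosed hg by (intro image_eqI[of _ _ "g y"]) auto
    qed (use closed fix_iff in auto)
    moreover have "inj_on h {x \<in> carrier G. \<psi> x [^]\<^bsub>G\<^esub> i = x}"
      using bij(1) by (auto simp: bij_betw_def inj_on_def)
    ultimately show ?thesis by (simp add: card_image)
  qed
  then have "Pi_fix p H \<psi>' = n" by (simp add: n Pi_fix_eq \<psi> auto')
  then show "n \<in> Spec_Pi p H" using auto' by (auto simp: Spec_Pi_def)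
qed

lemma Spec_Pi_iso:
  assumes "group G" "group H" "G \<cong> H"
  shows "Spec_Pi p G = Spec_Pi p H"
proof -
  obtain h where "h \<in> iso G H" using assms(3) by (auto simp: is_iso_def)
  then show ?thesis
    using Spec_Pi_iso_subset group.iso_set_sym assms(1,2) by (metis subset_antisym)
qed

text \<open>Every nonempty fibre of \<open>N\<close> embeds into its kernel by a translation.\<close>

lemma (in group) card_le_kernel_times_image:
  assumes "finite (carrier G)" and N: "N \<in> hom G G" and W: "W \<subseteq> carrier G" "N ` W \<subseteq> U" "finite U"
  shows "card W \<le> card {x \<in> carrier G. N x = \<one>} * card U"
proof -
  let ?K = "{x \<in> carrier G. N x = \<one>}"
  interpret N: group_hom G G N using N by unfold_locales
  have fiber: "card {x \<in> W. N x = u} \<le> card ?K" for u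
  proof (cases "\<exists>y\<in>W. N y = u")
    case True
    then obtain y where y: "y \<in> W" "N y = u" by blast
    then have yc: "y \<in> carrier G" using W by blast
    show ?thesis
    proof (rule card_inj_on_le[where f = "\<lambda>x. x \<otimes> inv y"])
      show "inj_on (\<lambda>x. x \<otimes> inv y) {x \<in> W. N x = u}"
      proof (rule inj_onI)
        fix a b assume "a \<in> {x \<in> W. N x = u}" "b \<in> {x \<in> W. N x = u}" "a \<otimes> inv y = b \<otimes> inv y"
        moreover from this have "a \<in> carrier G" "b \<in> carrier G" using W(1) by auto
        ultimately show "a = b" using right_cancel[of a b "inv y"] yc by simp
      qed
      show "(\<lambda>x. x \<otimes> inv y) ` {x \<in> W. N x = u} \<subseteq> ?K"
        using W(1) y yc by auto
      show "finite ?K" using assms(1) by simp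
    qed
  next
    case False
    then have "{x \<in> W. N x = u} = {}" by blast
    then show ?thesis by (metis card.empty zero_le)
  qed
  have "W = (\<Union>u\<in>U. {x \<in> W. N x = u})" using W(2) by blast
  then have "card W \<le> (\<Sum>u\<in>U. card {x \<in> W. N x = u})" using card_UN_le[OF W(3)] by metis
  also have "\<dots> \<le> (\<Sum>u\<in>U. card ?K)" by (intro sum_mono fiber)
  finally show ?thesis by (simp add: mult.commute)
qed

context comm_group
begin

text \<open>In additive notation this map is \<open>i \<phi> - 1\<close>, whose kernel consists of the fixed points of \<open>i \<phi>\<close>.\<close>

lemma twisted_difference_hom:
  assumes "\<phi> \<in> hom G G"
  shows "(\<lambda>x. \<phi> x [^] (i::int) \<otimes> inv x) \<in> hom G G"
proof (rule homI)
  interpret \<phi>: group_hom G G \<phi> using assms by unfold_locales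
  fix x y assume "x \<in> carrier G" "y \<in> carrier G"
  then show "\<phi> (x \<otimes> y) [^] i \<otimes> inv (x \<otimes> y) = \<phi> x [^] i \<otimes> inv x \<otimes> (\<phi> y [^] i \<otimes> inv y)"
    by (simp add: int_pow_distrib inv_mult m_ac)
qed (use assms in \<open>auto simp: hom_def Pi_iff\<close>)

lemma twisted_difference_eq_one_iff:
  assumes "\<phi> \<in> hom G G" "x \<in> carrier G"
  shows "\<phi> x [^] (i::int) \<otimes> inv x = \<one> \<longleftrightarrow> \<phi> x [^] i = x"
proof -
  have "\<phi> x \<in> carrier G" using assms by (auto simp: hom_def)
  then show ?thesis using assms(2) by (metis int_pow_closed inv_closed inv_equality inv_inv r_inv)
qed

text \<open>Here \<open>i \<phi>(x) = j \<phi>(x)\<close> with \<open>i - j\<close> prime to the order of \<open>\<phi>(x)\<close>.\<close>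

lemma distinct_eigenvalues:
  assumes "Factorial_Ring.prime p" "finite (carrier G)" "order G = p ^ k" and \<phi>: "\<phi> \<in> hom G G"
    and ij: "i \<in> {1..p - 1}" "j \<in> {1..p - 1}" "i \<noteq> j"
    and x: "x \<in> carrier G" "\<phi> x [^] int i = x" "\<phi> x [^] int j = x"
  shows "x = \<one>"
proof -
  have c: "\<phi> x \<in> carrier G" using \<phi> x by (auto simp: hom_def)
  have "\<phi> x [^] (int i - int j) = \<one>" using c x by (simp add: int_pow_diff)
  then have "int (ord (\<phi> x)) dvd int i - int j" using int_pow_eq_id[OF c] by simp
  moreover have "\<not> int p dvd int i - int j"
  proof
    assume "int p dvd int i - int j"
    moreover have "\<bar>int i - int j\<bar> < int p" using ij by auto
    ultimately show False using dvd_imp_le_int[of "int i - int j" "int p"] ij(3) by auto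
  qed
  ultimately have "\<not> p dvd ord (\<phi> x)" using dvd_trans int_dvd_int_iff by blast
  moreover have "ord (\<phi> x) dvd p ^ k" using ord_dvd_group_order[OF c] assms(3) by simp
  then obtain l where "ord (\<phi> x) = p ^ l" using divides_primepow_nat[OF assms(1)] by blast
  ultimately have "ord (\<phi> x) = 1" by (cases l) auto
  then have "\<phi> x = \<one>" using ord_eq_1[OF c] by simp
  then show ?thesis using x by simp
qed

text \<open>Independence of eigenspaces. For a set \<open>S\<close> of multipliers let \<open>\<psi>\<close> be the composition of all \<open>i \<phi> - 1\<close>,
  \<open>i \<in> S\<close>. It commutes with \<open>\<phi>\<close> and is injective on the eigenspaces outside \<open>S\<close>. When \<open>i\<close> is added to \<open>S\<close>,
  the new kernel contains the old kernel and the eigenspace of \<open>i\<close>, which meet trivially; so the order of the kernel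
  grows at least by the factor that is required.\<close>

lemma prod_card_power_fixed_points_le_order:
  assumes "Factorial_Ring.prime p" "finite (carrier G)" "order G = p ^ k" and \<phi>: "\<phi> \<in> hom G G"
  shows "(\<Prod>i = 1..p - 1. card {x \<in> carrier G. \<phi> x [^] int i = x}) \<le> order G"
proof -
  define K where "K i = {x \<in> carrier G. \<phi> x [^] int i = x}" for i
  interpret \<phi>: group_hom G G \<phi> using \<phi> by unfold_locales
  have "\<exists>\<psi>\<in>hom G G. (\<forall>x\<in>carrier G. \<psi> (\<phi> x) = \<phi> (\<psi> x)) \<and>
      (\<forall>j\<in>{1..p - 1} - S. \<forall>x\<in>K j. \<psi> x = \<one> \<longrightarrow> x = \<one>) \<and>
      (\<Prod>i\<in>S. card (K i)) \<le> card {x \<in> carrier G. \<psi> x = \<one>}"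
    if "finite S" "S \<subseteq> {1..p - 1}" for S
    using that
  proof (induction S rule: finite_induct)
    case empty
    have "(\<lambda>x. x) \<in> hom G G" by (simp add: hom_def)
    moreover have "{x \<in> carrier G. x = \<one>} = {\<one>}" by auto
    ultimately show ?case by (intro bexI[of _ "\<lambda>x. x"]) auto
  next
    case (insert i S)
    then obtain \<psi> where \<psi>: "\<psi> \<in> hom G G" and comm: "\<And>x. x \<in> carrier G \<Longrightarrow> \<psi> (\<phi> x) = \<phi> (\<psi> x)"
      and inj: "\<And>j x. j \<in> {1..p - 1} - S \<Longrightarrow> x \<in> K j \<Longrightarrow> \<psi> x = \<one> \<Longrightarrow> x = \<one>"
      and card: "(\<Prod>i\<in>S. card (K i)) \<le> card {x \<in> carrier G. \<psi> x = \<one>}"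
      by auto
    interpret \<psi>: group_hom G G \<psi> using \<psi> by unfold_locales
    define N where "N = (\<lambda>x. \<phi> x [^] int i \<otimes> inv x)"
    have "N \<in> hom G G" unfolding N_def using \<phi> by (rule twisted_difference_hom)
    then interpret N: group_hom G G N by unfold_locales
    have N_one: "N x = \<one> \<longleftrightarrow> x \<in> K i" if "x \<in> carrier G" for x
      using twisted_difference_eq_one_iff[OF \<phi> that] that by (simp add: N_def K_def)
    have \<phi>N: "\<phi> (N x) = N (\<phi> x)" if "x \<in> carrier G" for x
      using that by (simp add: N_def \<phi>.hom_int_pow)
    have \<psi>N: "\<psi> (N x) = N (\<psi> x)" if "x \<in> carrier G" for x
      using that by (simp add: N_def \<psi>.hom_int_pow comm)
    have "(\<lambda>x. \<psi> (N x)) \<in> hom G G" by (simp add: hom_def)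
    moreover have "\<forall>x\<in>carrier G. \<psi> (N (\<phi> x)) = \<phi> (\<psi> (N x))"
    proof
      fix x assume "x \<in> carrier G"
      then show "\<psi> (N (\<phi> x)) = \<phi> (\<psi> (N x))" using comm[of "N x"] \<phi>N[of x] by simp
    qed
    moreover have "\<forall>j\<in>{1..p - 1} - insert i S. \<forall>x\<in>K j. \<psi> (N x) = \<one> \<longrightarrow> x = \<one>"
    proof (intro ballI impI)
      fix j x assume j: "j \<in> {1..p - 1} - insert i S" and x: "x \<in> K j" and one: "\<psi> (N x) = \<one>"
      then have xc: "x \<in> carrier G" and xj: "\<phi> x [^] int j = x" by (auto simp: K_def)
      have "\<phi> (N x) [^] int j = N (\<phi> x [^] int j)" using N.hom_int_pow[of "\<phi> x" "int j"] xc \<phi>N[OF xc] by simp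
      then have "\<phi> (N x) [^] int j = N x" unfolding xj .
      then have "N x \<in> K j" using xc by (simp add: K_def)
      then have "N x = \<one>" using inj[of j "N x"] j one by blast
      then have "\<phi> x [^] int i = x" using N_one xc by (simp add: K_def)
      then show "x = \<one>"
        using distinct_eigenvalues[OF assms(1-3) \<phi>, of i j x] j insert.prems xc xj by auto
    qed
    moreover have "(\<Prod>i\<in>insert i S. card (K i)) \<le> card {x \<in> carrier G. \<psi> (N x) = \<one>}"
    proof -
      let ?A = "{x \<in> carrier G. \<psi> x = \<one>}"
      have "inj_on (\<lambda>(a, b). a \<otimes> b) (?A \<times> K i)"
      proof (rule inj_onI, clarify)
        fix a b a' b'
        assume a: "a \<in> carrier G" "\<psi> a = \<one>" "a' \<in> carrier G" "\<psi> a' = \<one>"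
          and b: "b \<in> K i" "b' \<in> K i" and eq: "a \<otimes> b = a' \<otimes> b'"
        have bc: "b \<in> carrier G" "b' \<in> carrier G" and bi: "\<phi> b [^] int i = b" "\<phi> b' [^] int i = b'"
          using b by (auto simp: K_def)
        have "inv a' \<otimes> a = b' \<otimes> inv b"
        proof -
          have "inv a' \<otimes> a = inv a' \<otimes> (a \<otimes> b) \<otimes> inv b" using a bc by (simp add: m_assoc)
          also have "\<dots> = b' \<otimes> inv b" unfolding eq using a bc by (simp add: m_assoc[symmetric])
          finally show ?thesis .
        qed
        moreover have "b' \<otimes> inv b \<in> K i"
          using bc bi by (simp add: K_def int_pow_distrib int_pow_inv)
        moreover have "\<psi> (inv a' \<otimes> a) = \<one>" using a by simp
        ultimately have "b' \<otimes> inv b = \<one>" using inj[of i "b' \<otimes> inv b"] insert by auto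
        then have "b' = b" using bc by (metis inv_closed inv_equality inv_inv)
        with eq a bc show "a = a' \<and> b = b'" by simp
      qed
      moreover have "(\<lambda>(a, b). a \<otimes> b) ` (?A \<times> K i) \<subseteq> {x \<in> carrier G. \<psi> (N x) = \<one>}"
      proof clarify
        fix a b assume a: "a \<in> carrier G" "\<psi> a = \<one>" and b: "b \<in> K i"
        then have bc: "b \<in> carrier G" by (simp add: K_def)
        with b have "N b = \<one>" using N_one by blast
        moreover have "\<psi> (N a) = \<one>" using a by (simp add: \<psi>N)
        ultimately show "a \<otimes> b \<in> carrier G \<and> \<psi> (N (a \<otimes> b)) = \<one>" using a bc by simp
      qed
      ultimately have "card (?A \<times> K i) \<le> card {x \<in> carrier G. \<psi> (N x) = \<one>}"
        using assms(2) by (intro card_inj_on_le) auto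
      moreover have "(\<Prod>i\<in>insert i S. card (K i)) \<le> card (?A \<times> K i)"
        using insert.hyps card by (simp add: card_cartesian_product mult.commute)
      ultimately show ?thesis by linarith
    qed
    ultimately show ?case by (intro bexI[of _ "\<lambda>x. \<psi> (N x)"]) auto
  qed
  from this[of "{1..p - 1}"] obtain \<psi> where
    "(\<Prod>i = 1..p - 1. card (K i)) \<le> card {x \<in> carrier G. \<psi> x = \<one>}" by auto
  also have "\<dots> \<le> order G" unfolding order_def using assms(2) by (intro card_mono) auto
  finally show ?thesis by (simp add: K_def)
qed

lemma card_power_fixed_points_prime_power:
  assumes "Factorial_Ring.prime p" "finite (carrier G)" "order G = p ^ k" and \<phi>: "\<phi> \<in> hom G G"
  shows "\<exists>m. card {x \<in> carrier G. \<phi> x [^] (i::int) = x} = p ^ m"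
proof -
  let ?N = "\<lambda>x. \<phi> x [^] i \<otimes> inv x"
  interpret N: group_hom G G ?N using twisted_difference_hom[OF \<phi>] by unfold_locales
  have K: "kernel G G ?N = {x \<in> carrier G. \<phi> x [^] i = x}"
    using twisted_difference_eq_one_iff[OF \<phi>] by (auto simp: kernel_def)
  have "card (kernel G G ?N) dvd order G"
    unfolding lagrange[OF N.subgroup_kernel, symmetric] by (rule dvd_triv_right)
  then have "card {x \<in> carrier G. \<phi> x [^] i = x} dvd p ^ k"
    unfolding K assms(3) .
  then show ?thesis using divides_primepow_nat[OF assms(1)] by blast
qed

end

section \<open>Endomorphisms of a direct sum of cyclic groups\<close>

locale cyclic_sum = prime_power_moduli +
  fixes I :: "nat set"
  assumes finite_I: "finite I" and d_pos: "\<And>i. i \<in> I \<Longrightarrow> 1 \<le> d i"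
begin

definition G :: "(nat \<Rightarrow> int) monoid" where
  "G = sum_group I (\<lambda>i. integer_mod_group (p ^ d i))"

lemma carrier_G: "carrier G = coords I"
proof -
  have "p ^ d i \<noteq> 0" for i by simp
  then show ?thesis
    unfolding G_def using finite_I
    by (subst carrier_sum_group) (auto simp: coords_def carrier_integer_mod_group)
qed

lemma mult_G: "x \<otimes>\<^bsub>G\<^esub> y = (\<lambda>i\<in>I. (x i + y i) mod int p ^ d i)"
  by (simp add: G_def)

lemma one_G: "\<one>\<^bsub>G\<^esub> = (\<lambda>i\<in>I. 0)"
  by (simp add: G_def)

lemma group_G: "group G"
  unfolding G_def by (rule sum_group) simp

lemma comm_group_G: "comm_group G"
  by (rule group.group_comm_groupI[OF group_G]) (simp add: mult_G add.commute)

lemma finite_G: "finite (carrier G)"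
  by (simp add: carrier_G finite_coords finite_I)

sublocale G: comm_group G
  by (rule comm_group_G)

lemma order_G: "order G = p ^ sum d I"
proof -
  have "order G = card {x \<in> coords I. \<forall>i\<in>I. int p ^ 0 dvd x i}" by (simp add: order_def carrier_G)
  also have "\<dots> = p ^ (\<Sum>i\<in>I. d i - 0)" using finite_I by (intro card_coords_multiples) auto
  finally show ?thesis by simp
qed

lemma coords_mod [simp]: "x \<in> coords I \<Longrightarrow> i \<in> I \<Longrightarrow> x i mod int p ^ d i = x i"
  by (auto simp: coords_def PiE_iff)

lemma coordinate_hom:
  assumes "i \<in> I"
  shows "(\<lambda>x. x i) \<in> hom G (integer_mod_group (p ^ d i))"
  using assms by (auto simp: hom_def mult_G carrier_G coords_def carrier_integer_mod_group)

lemma pow_coordinate: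
  assumes "x \<in> carrier G" "i \<in> I"
  shows "(x [^]\<^bsub>G\<^esub> (k::int)) i = (k * x i) mod int p ^ d i"
  using hom_int_pow[OF coordinate_hom[OF assms(2)] assms(1) group_G group_integer_mod_group, of k]
  by (simp add: int_pow_integer_mod_group)

lemma coords_eqI:
  assumes "x \<in> coords I" "y \<in> coords I" "\<And>i. i \<in> I \<Longrightarrow> x i = y i"
  shows "x = y"
  using assms unfolding coords_def by (rule PiE_ext)

text \<open>The standard generators; since homomorphisms are determined by their values there, \<open>N (gen j) i\<close> plays the
  role of a matrix entry.\<close>

definition gen :: "nat \<Rightarrow> nat \<Rightarrow> int" where
  "gen j = (\<lambda>i\<in>I. if i = j then 1 else 0)"

lemma gen_closed: "gen j \<in> carrier G"
proof -
  have "1 < int p ^ d i" if "i \<in> I" for i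
    using d_pos[OF that] p_gt_1 by (intro one_less_power) auto
  then show ?thesis by (auto simp: carrier_G coords_def gen_def)
qed

text \<open>Both sides are additive in \<open>x\<close>, and \<open>x\<close> is built up one coordinate at a time.\<close>

lemma hom_coordinate:
  assumes N: "N \<in> hom G G" and x: "x \<in> carrier G" and i: "i \<in> I"
  shows "N x i = (\<Sum>j\<in>I. x j * N (gen j) i) mod int p ^ d i"
proof -
  interpret N: group_hom G G N using N by unfold_locales
  define r where "r J = (\<lambda>i\<in>I. if i \<in> J then x i else 0)" for J
  have rc: "r J \<in> carrier G" for J using x by (auto simp: r_def carrier_G coords_def)
  have "N (r J) i = (\<Sum>j\<in>J. x j * N (gen j) i) mod int p ^ d i" if "finite J" "J \<subseteq> I" for J
    using that
  proof (induction J rule: finite_induct)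
    case empty
    have r: "r {} = \<one>\<^bsub>G\<^esub>" by (auto simp: r_def one_G)
    have "N (r {}) = \<one>\<^bsub>G\<^esub>" unfolding r by (rule N.hom_one)
    then show ?case using i by (simp add: one_G)
  next
    case (insert j J)
    have "r (insert j J) = r J \<otimes>\<^bsub>G\<^esub> gen j [^]\<^bsub>G\<^esub> x j"
    proof (rule coords_eqI)
      show "r (insert j J) \<in> coords I" using rc by (simp add: carrier_G)
      show "r J \<otimes>\<^bsub>G\<^esub> gen j [^]\<^bsub>G\<^esub> x j \<in> coords I"
        using rc gen_closed by (simp flip: carrier_G)
      fix k assume k: "k \<in> I"
      have "x k mod int p ^ d k = x k" using x k by (simp add: carrier_G)
      then show "r (insert j J) k = (r J \<otimes>\<^bsub>G\<^esub> gen j [^]\<^bsub>G\<^esub> x j) k"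
        using k insert.hyps(2) gen_closed[of j] by (auto simp: mult_G pow_coordinate) (auto simp: r_def gen_def)
    qed
    then have "N (r (insert j J)) = N (r J) \<otimes>\<^bsub>G\<^esub> N (gen j) [^]\<^bsub>G\<^esub> x j"
      using rc gen_closed by (simp add: N.hom_int_pow)
    then have "N (r (insert j J)) i = (N (r J) i + x j * N (gen j) i mod int p ^ d i) mod int p ^ d i"
      using i gen_closed by (simp add: mult_G pow_coordinate)
    also have "\<dots> = ((\<Sum>j\<in>J. x j * N (gen j) i) + x j * N (gen j) i) mod int p ^ d i"
      using insert by (simp add: mod_add_eq)
    finally show ?case using insert.hyps by (simp add: add.commute)
  qed
  from this[OF finite_I subset_refl] have "N (r I) i = (\<Sum>j\<in>I. x j * N (gen j) i) mod int p ^ d i" .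
  moreover have "r I = x" using x by (intro coords_eqI) (use rc in \<open>auto simp: r_def carrier_G\<close>)
  ultimately show ?thesis by simp
qed

text \<open>The image of \<open>gen j\<close> is killed by \<open>p ^ d j\<close>.\<close>

lemma hom_entry_divisible:
  assumes N: "N \<in> hom G G" and ij: "i \<in> I" "j \<in> I"
  shows "int p ^ (d i - d j) dvd N (gen j) i"
proof (cases "d j \<le> d i")
  case True
  interpret N: group_hom G G N using N by unfold_locales
  have "gen j [^]\<^bsub>G\<^esub> (int p ^ d j) = \<one>\<^bsub>G\<^esub>"
  proof (rule coords_eqI)
    show "gen j [^]\<^bsub>G\<^esub> (int p ^ d j) \<in> coords I" "\<one>\<^bsub>G\<^esub> \<in> coords I"
      using gen_closed by (simp_all flip: carrier_G)
    fix k assume "k \<in> I"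
    then show "(gen j [^]\<^bsub>G\<^esub> (int p ^ d j)) k = \<one>\<^bsub>G\<^esub> k"
      using gen_closed by (auto simp: pow_coordinate one_G gen_def)
  qed
  then have "N (gen j) [^]\<^bsub>G\<^esub> (int p ^ d j) = \<one>\<^bsub>G\<^esub>"
    using N.hom_int_pow[OF gen_closed, of j "int p ^ d j"] by simp
  then have "(int p ^ d j * N (gen j) i) mod int p ^ d i = 0"
    using pow_coordinate[of "N (gen j)" i "int p ^ d j"] gen_closed ij by (simp add: one_G)
  then have "int p ^ d j * int p ^ (d i - d j) dvd int p ^ d j * N (gen j) i"
    using True by (simp add: mod_eq_0_iff_dvd flip: power_add)
  then show ?thesis by simp
qed simp

text \<open>The two properties of the set of leaders on which the lower bound rests.\<close>

definition sparse :: "nat set \<Rightarrow> bool" where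
  "sparse T \<longleftrightarrow> T \<subseteq> I \<and> (\<forall>t\<in>T. \<forall>j\<in>I. d j = d t \<longrightarrow> j = t) \<and> (\<forall>s\<in>T. \<forall>t\<in>T. d t \<noteq> d s + 1)"

lemma sparse_subset: "sparse T \<Longrightarrow> S \<subseteq> T \<Longrightarrow> sparse S"
  unfolding sparse_def by blast

lemma sparse_count_le:
  assumes T: "sparse T" and "\<And>t. t \<in> S \<Longrightarrow> t \<in> T \<and> a \<le> d t \<and> d t < b"
  shows "card S \<le> b - a"
proof -
  have "inj_on d S" using assms unfolding sparse_def by (intro inj_onI) (metis subsetD)
  moreover have "d ` S \<subseteq> {a..<b}" using assms by auto
  ultimately have "card S \<le> card {a..<b}" by (rule card_inj_on_le) simp
  then show ?thesis by simp
qed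

text \<open>Let \<open>w i\<close> count the elements of \<open>T\<close> with exponent below \<open>d i\<close>, and let \<open>u i\<close> be \<open>w i\<close>, plus one if \<open>i \<in> T\<close>.
  Let \<open>W\<close> and \<open>U\<close> consist of the \<open>x\<close> with \<open>p ^ w i\<close> resp. \<open>p ^ u i\<close> dividing \<open>x i\<close>, so that \<open>|W / U| = p ^ |T|\<close>.
  As a function of the exponent, \<open>w\<close> is nondecreasing and grows by at most one per step; near the exponent of an
  element \<open>t\<close> of \<open>T\<close> it stays constant in the step before, since no exponent in \<open>T\<close> is smaller by exactly one, and
  grows by one in the step after. These slopes are what is needed to compare with the divisibility of the entries
  of \<open>N\<close> and to conclude that \<open>N\<close> maps \<open>W\<close> into \<open>U\<close>.\<close>

lemma card_kernel_ge_of_sparse: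
  assumes N: "N \<in> hom G G" and T: "sparse T" and diag: "\<And>t. t \<in> T \<Longrightarrow> int p dvd N (gen t) t"
  shows "p ^ card T \<le> card {x \<in> carrier G. N x = \<one>\<^bsub>G\<^esub>}"
proof -
  have TI: "T \<subseteq> I" and uniq: "\<And>t j. t \<in> T \<Longrightarrow> j \<in> I \<Longrightarrow> d j = d t \<Longrightarrow> j = t"
    and gap: "\<And>s t. s \<in> T \<Longrightarrow> t \<in> T \<Longrightarrow> d t \<noteq> d s + 1"
    using T unfolding sparse_def by blast+
  have finT: "finite T" using TI finite_I by (rule finite_subset)
  define w where "w i = card {t \<in> T. d t < d i}" for i
  define u where "u i = w i + (if i \<in> T then 1 else 0)" for i
  have w_less: "w i < d i" if "i \<in> I" for i
  proof -
    have "w i \<le> d i - 1" unfolding w_def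
      using TI d_pos by (intro sparse_count_le[OF T]) auto
    then show ?thesis using d_pos[OF that] by linarith
  qed
  have u_le: "u i \<le> d i" if "i \<in> I" for i
    using w_less[OF that] by (simp add: u_def)
  \<comment> \<open>With truncated subtraction: the entry from \<open>j\<close> to \<open>i\<close> is divisible by \<open>p\<close> to the power \<open>d i - d j\<close>.\<close>
  have step: "u i \<le> w j + (d i - d j)" if ij: "i \<in> I" "j \<in> I" and ne: "i \<in> T \<Longrightarrow> i \<noteq> j" for i j
  proof (cases "i \<in> T \<and> d i \<le> d j")
    case True
    then have "d i < d j" using uniq ij ne by (metis le_neq_implies_less)
    then have "insert i {t \<in> T. d t < d i} \<subseteq> {t \<in> T. d t < d j}" using True by auto
    then have "card (insert i {t \<in> T. d t < d i}) \<le> w j"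
      unfolding w_def using finT by (intro card_mono) auto
    then show ?thesis using True finT by (simp add: u_def w_def)
  next
    case False
    let ?S = "{t \<in> T. d j \<le> d t \<and> d t < d i}"
    have "{t \<in> T. d t < d i} \<subseteq> {t \<in> T. d t < d j} \<union> ?S" by auto
    then have "w i \<le> card ({t \<in> T. d t < d j} \<union> ?S)"
      unfolding w_def using finT by (intro card_mono) auto
    also have "\<dots> \<le> w j + card ?S" unfolding w_def by (rule card_Un_le)
    finally have wi: "w i \<le> w j + card ?S" .
    show ?thesis
    proof (cases "i \<in> T")
      case True
      have "card ?S \<le> (d i - 1) - d j"
      proof (rule sparse_count_le[OF T])
        fix t assume t: "t \<in> ?S"
        then have "d t \<noteq> d i - 1" using gap[of t i] True by auto
        with t show "t \<in> T \<and> d j \<le> d t \<and> d t < d i - 1" by auto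
      qed
      then show ?thesis using wi True False by (simp add: u_def)
    next
      case False
      have "card ?S \<le> d i - d j" by (rule sparse_count_le[OF T]) auto
      then show ?thesis using wi False by (simp add: u_def)
    qed
  qed
  have entry: "int p ^ u i dvd int p ^ w j * N (gen j) i" if ij: "i \<in> I" "j \<in> I" for i j
  proof (cases "i \<in> T \<and> i = j")
    case True
    then show ?thesis using diag[of j] by (simp add: u_def mult.commute)
  next
    case False
    then have "u i \<le> w j + (d i - d j)" using step ij by blast
    then have "int p ^ u i dvd int p ^ w j * int p ^ (d i - d j)"
      by (simp add: le_imp_power_dvd flip: power_add)
    then show ?thesis using hom_entry_divisible[OF N ij] by (meson dvd_trans mult_dvd_mono dvd_refl)
  qed
  define W where "W = {x \<in> coords I. \<forall>i\<in>I. int p ^ w i dvd x i}"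
  define U where "U = {x \<in> coords I. \<forall>i\<in>I. int p ^ u i dvd x i}"
  have "N ` W \<subseteq> U"
  proof clarify
    fix x assume x: "x \<in> W"
    then have xc: "x \<in> carrier G" by (simp add: W_def carrier_G)
    have "int p ^ u i dvd N x i" if i: "i \<in> I" for i
    proof -
      have "int p ^ u i dvd x j * N (gen j) i" if j: "j \<in> I" for j
      proof -
        have "int p ^ w j * N (gen j) i dvd x j * N (gen j) i"
          using x j by (intro mult_dvd_mono) (auto simp: W_def)
        then show ?thesis using entry[OF i j] dvd_trans by blast
      qed
      then have "int p ^ u i dvd (\<Sum>j\<in>I. x j * N (gen j) i)" by (rule dvd_sum)
      moreover have "int p ^ u i dvd int p ^ d i" using u_le[OF i] by (rule le_imp_power_dvd)
      ultimately show ?thesis unfolding hom_coordinate[OF N xc i] by (rule dvd_mod)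
    qed
    moreover have "N x \<in> coords I" using N xc by (auto simp: hom_def carrier_G)
    ultimately show "N x \<in> U" by (simp add: U_def)
  qed
  then have "card W \<le> card {x \<in> carrier G. N x = \<one>\<^bsub>G\<^esub>} * card U"
    using N finite_G by (intro G.card_le_kernel_times_image) (auto simp: W_def U_def carrier_G)
  moreover have "card U = p ^ (\<Sum>i\<in>I. d i - u i)"
    unfolding U_def using finite_I u_le by (intro card_coords_multiples)
  moreover have "card W = p ^ (\<Sum>i\<in>I. d i - u i) * p ^ card T"
  proof -
    have "card W = p ^ (\<Sum>i\<in>I. d i - w i)"
      unfolding W_def using finite_I w_less by (intro card_coords_multiples) (auto intro: less_imp_le)
    also have "(\<Sum>i\<in>I. d i - w i) = (\<Sum>i\<in>I. (d i - u i) + (if i \<in> T then 1 else 0))"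
      using w_less by (intro sum.cong) (auto simp: u_def Suc_diff_Suc)
    also have "\<dots> = (\<Sum>i\<in>I. d i - u i) + card T"
      using finite_I TI by (simp add: sum.distrib sum.If_cases Int_absorb1)
    finally show ?thesis by (simp add: power_add)
  qed
  ultimately show ?thesis by (simp add: mult.commute)
qed

text \<open>Otherwise the kernel bound, applied to \<open>\<phi>\<close> itself and the singleton \<open>{t}\<close>, would contradict injectivity.\<close>

lemma diagonal_entry_unit:
  assumes \<phi>: "\<phi> \<in> auto G" and t: "t \<in> I" and uniq: "\<And>j. j \<in> I \<Longrightarrow> d j = d t \<Longrightarrow> j = t"
  shows "\<not> int p dvd \<phi> (gen t) t"
proof
  assume dvd: "int p dvd \<phi> (gen t) t"
  interpret \<phi>: group_hom G G \<phi> using auto_hom[OF \<phi>] by unfold_locales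
  have "sparse {t}" using t uniq by (auto simp: sparse_def)
  then have "p ^ card {t} \<le> card {x \<in> carrier G. \<phi> x = \<one>\<^bsub>G\<^esub>}"
    using dvd by (intro card_kernel_ge_of_sparse[OF auto_hom[OF \<phi>]]) auto
  moreover have "inj_on \<phi> (carrier G)" using \<phi> by (auto simp: auto_def Bij_def bij_betw_def)
  then have "{x \<in> carrier G. \<phi> x = \<one>\<^bsub>G\<^esub>} = {\<one>\<^bsub>G\<^esub>}" using \<phi>.inj_on_one_iff by auto
  ultimately show False using p_gt_1 by simp
qed

lemma ex_inverse_residue:
  assumes "\<not> int p dvd a"
  shows "\<exists>i\<in>{1..p - 1}. int p dvd int i * a - 1"
proof -
  have "coprime a (int p)" using coprime_modulus[OF assms, of 1] by (simp add: coprime_commute)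
  then obtain b c where "b * a + c * int p = 1" using bezout_int[of a "int p"] by auto
  then have "a * b - 1 = int p * (- c)" by (simp add: algebra_simps)
  then have b: "int p dvd a * b - 1" by (rule dvdI)
  define i where "i = nat (b mod int p)"
  have i: "int i = b mod int p" "i < p" by (simp_all add: i_def nat_less_iff)
  have "int p dvd (b mod int p - b) * a" by (simp add: mod_eq_dvd_iff[symmetric])
  then have "int p dvd (a * b - 1) + (b mod int p - b) * a" using b by simp
  then have dvd: "int p dvd int i * a - 1" by (simp add: i algebra_simps)
  have "i \<noteq> 0"
  proof
    assume "i = 0"
    with dvd have "int p dvd 1" by simp
    then show False using p_gt_1 by simp
  qed
  with i(2) dvd show ?thesis by (intro bexI[of _ i]) auto
qed

text \<open>Each element of \<open>T\<close> is charged to a multiplier \<open>i\<close> that inverts the diagonal entry of \<open>\<phi>\<close> there, and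
  the kernel bound is applied to \<open>i \<phi> - 1\<close> and the set \<open>S i\<close> of elements charged to \<open>i\<close>.\<close>

lemma prod_card_power_fixed_points_ge:
  assumes \<phi>: "\<phi> \<in> auto G" and T: "sparse T"
  shows "p ^ card T \<le> (\<Prod>i = 1..p - 1. card {x \<in> carrier G. \<phi> x [^]\<^bsub>G\<^esub> int i = x})"
proof -
  define S where "S i = {t \<in> T. int p dvd int i * \<phi> (gen t) t - 1}" for i
  have TI: "T \<subseteq> I" using T by (simp add: sparse_def)
  then have finT: "finite T" using finite_I by (rule finite_subset)
  note hom = auto_hom[OF \<phi>]
  have "p ^ card (S i) \<le> card {x \<in> carrier G. \<phi> x [^]\<^bsub>G\<^esub> int i = x}" for i
  proof -
    let ?N = "\<lambda>x. \<phi> x [^]\<^bsub>G\<^esub> int i \<otimes>\<^bsub>G\<^esub> inv\<^bsub>G\<^esub> x"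
    have "p ^ card (S i) \<le> card {x \<in> carrier G. ?N x = \<one>\<^bsub>G\<^esub>}"
    proof (rule card_kernel_ge_of_sparse)
      show "?N \<in> hom G G" using hom by (rule G.twisted_difference_hom)
      show "sparse (S i)" using T by (rule sparse_subset) (auto simp: S_def)
      fix t assume t: "t \<in> S i"
      then have tI: "t \<in> I" using TI by (auto simp: S_def)
      have c: "\<phi> (gen t) \<in> carrier G" using hom gen_closed by (auto simp: hom_def)
      \<comment> \<open>The inverse is written as a power so that coordinates of powers cover it.\<close>
      have "?N (gen t) = \<phi> (gen t) [^]\<^bsub>G\<^esub> int i \<otimes>\<^bsub>G\<^esub> gen t [^]\<^bsub>G\<^esub> (-1::int)"
        using gen_closed by (simp add: G.int_pow_neg)
      then have "?N (gen t) t = (int i * \<phi> (gen t) t - 1) mod int p ^ d t"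
        using tI c gen_closed
        by (simp add: mult_G pow_coordinate) (simp add: gen_def mod_simps)
      moreover have "int p dvd int p ^ d t" using d_pos[OF tI] by (intro dvd_power) auto
      ultimately show "int p dvd ?N (gen t) t" using t by (simp add: S_def dvd_mod)
    qed
    also have "{x \<in> carrier G. ?N x = \<one>\<^bsub>G\<^esub>} = {x \<in> carrier G. \<phi> x [^]\<^bsub>G\<^esub> int i = x}"
      by (intro Collect_cong conj_cong refl G.twisted_difference_eq_one_iff hom)
    finally show ?thesis .
  qed
  then have "(\<Prod>i = 1..p - 1. p ^ card (S i)) \<le> (\<Prod>i = 1..p - 1. card {x \<in> carrier G. \<phi> x [^]\<^bsub>G\<^esub> int i = x})"
    by (intro prod_mono) auto
  moreover have "p ^ card T \<le> (\<Prod>i = 1..p - 1. p ^ card (S i))"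
  proof -
    have "T \<subseteq> (\<Union>i\<in>{1..p - 1}. S i)"
    proof
      fix t assume t: "t \<in> T"
      then have "\<not> int p dvd \<phi> (gen t) t"
        using T by (intro diagonal_entry_unit[OF \<phi>]) (auto simp: sparse_def)
      then show "t \<in> (\<Union>i\<in>{1..p - 1}. S i)" using ex_inverse_residue t by (auto simp: S_def)
    qed
    then have "card T \<le> card (\<Union>i\<in>{1..p - 1}. S i)"
      using finT by (intro card_mono) (auto simp: S_def)
    also have "\<dots> \<le> (\<Sum>i = 1..p - 1. card (S i))" by (rule card_UN_le) simp
    finally have "p ^ card T \<le> p ^ (\<Sum>i = 1..p - 1. card (S i))"
      using p_gt_1 by (intro power_increasing) auto
    then show ?thesis by (simp add: power_sum)
  qed
  ultimately show ?thesis by linarith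
qed

lemma Pi_fix_bounds:
  assumes \<phi>: "\<phi> \<in> auto G" and T: "sparse T"
  shows "\<exists>m. Pi_fix p G \<phi> = p ^ m \<and> card T \<le> m \<and> m \<le> sum d I"
proof -
  let ?c = "\<lambda>i::nat. card {x \<in> carrier G. \<phi> x [^]\<^bsub>G\<^esub> int i = x}"
  note hom = auto_hom[OF \<phi>]
  have "\<exists>m. ?c i = p ^ m" for i
    by (rule G.card_power_fixed_points_prime_power[OF prime_p finite_G order_G hom])
  then obtain f where "\<And>i. ?c i = p ^ f i" by metis
  then have "(\<Prod>i = 1..p - 1. ?c i) = p ^ (\<Sum>i = 1..p - 1. f i)" by (simp add: power_sum)
  moreover have "(\<Prod>i = 1..p - 1. ?c i) \<le> p ^ sum d I"
    using G.prod_card_power_fixed_points_le_order[OF prime_p finite_G order_G hom] order_G by simp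
  moreover note prod_card_power_fixed_points_ge[OF \<phi> T]
  ultimately show ?thesis
    using p_gt_1 by (intro exI[of _ "\<Sum>i = 1..p - 1. f i"]) (simp add: Pi_fix_eq[OF \<phi>])
qed

lemma realizable_imp_Spec_Pi:
  assumes "realizable I m"
  shows "p ^ m \<in> Spec_Pi p G"
proof -
  from assms obtain M where M: "compatible I M" and ker: "card (solutions I M 1 0) = 1"
    and prod: "(\<Prod>k = 1..p - 1. card (solutions I M (int k) 1)) = p ^ m"
    unfolding realizable_def by blast
  define \<phi> where "\<phi> = (\<lambda>x\<in>coords I. \<lambda>i\<in>I. lin I M x i mod int p ^ d i)"
  have closed: "\<phi> x \<in> carrier G" if "x \<in> carrier G" for x
    using that by (auto simp: \<phi>_def carrier_G coords_def)
  have hom: "\<phi> \<in> hom G G"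
  proof (rule homI)
    fix x y assume xy: "x \<in> carrier G" "y \<in> carrier G"
    then have "x \<otimes>\<^bsub>G\<^esub> y \<in> carrier G" by simp
    then have sum: "\<phi> (x \<otimes>\<^bsub>G\<^esub> y) = (\<lambda>i\<in>I. lin I M (x \<otimes>\<^bsub>G\<^esub> y) i mod int p ^ d i)"
      by (simp add: \<phi>_def carrier_G)
    have "lin I M (x \<otimes>\<^bsub>G\<^esub> y) i mod int p ^ d i = (lin I M x i + lin I M y i) mod int p ^ d i"
      if i: "i \<in> I" for i
    proof -
      have "int p ^ d i dvd M i j * ((x j + y j) mod int p ^ d j - (x j + y j))" if "j \<in> I" for j
      proof -
        have "int p ^ d j dvd (x j + y j) mod int p ^ d j - (x j + y j)"
          by (simp add: mod_eq_dvd_iff[symmetric])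
        then have "M i j * int p ^ d j dvd M i j * ((x j + y j) mod int p ^ d j - (x j + y j))"
          by (rule mult_dvd_mono[OF dvd_refl])
        moreover have "int p ^ d i dvd M i j * int p ^ d j"
          using M i that by (simp add: compatible_def)
        ultimately show ?thesis by (rule dvd_trans[rotated])
      qed
      then have "int p ^ d i dvd (\<Sum>j\<in>I. M i j * ((x j + y j) mod int p ^ d j - (x j + y j)))"
        by (rule dvd_sum)
      also have "\<dots> = lin I M (x \<otimes>\<^bsub>G\<^esub> y) i - (lin I M x i + lin I M y i)"
        by (simp add: lin_def mult_G algebra_simps sum.distrib sum_subtractf)
      finally show ?thesis by (simp add: mod_eq_dvd_iff)
    qed
    then show "\<phi> (x \<otimes>\<^bsub>G\<^esub> y) = \<phi> x \<otimes>\<^bsub>G\<^esub> \<phi> y"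
      using xy unfolding sum by (auto simp: \<phi>_def mult_G carrier_G mod_simps intro!: restrict_ext)
  qed (rule closed)
  interpret \<phi>: group_hom G G \<phi> using hom by unfold_locales
  have fixed: "\<phi> x [^]\<^bsub>G\<^esub> k = x \<longleftrightarrow> x \<in> solutions I M k 1" if x: "x \<in> carrier G" for x k
  proof -
    have "(\<phi> x [^]\<^bsub>G\<^esub> k) i = x i \<longleftrightarrow> int p ^ d i dvd k * lin I M x i - 1 * x i" if i: "i \<in> I" for i
    proof -
      have "(\<phi> x [^]\<^bsub>G\<^esub> k) i = (k * lin I M x i) mod int p ^ d i"
        using x i closed[OF x] by (simp add: pow_coordinate) (simp add: \<phi>_def carrier_G mod_simps)
      moreover have "x i = x i mod int p ^ d i" using x i by (simp add: carrier_G)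
      ultimately show ?thesis by (metis mod_eq_dvd_iff mult_1)
    qed
    moreover have "\<phi> x [^]\<^bsub>G\<^esub> k = x \<longleftrightarrow> (\<forall>i\<in>I. (\<phi> x [^]\<^bsub>G\<^esub> k) i = x i)"
      using x closed[OF x] coords_eqI[of "\<phi> x [^]\<^bsub>G\<^esub> k" x] by (auto simp flip: carrier_G)
    ultimately show ?thesis using x by (simp add: solutions_def carrier_G)
  qed
  have "inj_on \<phi> (carrier G)"
  proof (subst \<phi>.inj_on_one_iff, intro allI impI)
    fix x assume x: "x \<in> carrier G" and one: "\<phi> x = \<one>\<^bsub>G\<^esub>"
    have "int p ^ d i dvd lin I M x i" if "i \<in> I" for i
      using fun_cong[OF one, of i] x that by (simp add: \<phi>_def one_G carrier_G mod_eq_0_iff_dvd)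
    then have "x \<in> solutions I M 1 0" using x by (simp add: solutions_def carrier_G)
    moreover have "\<one>\<^bsub>G\<^esub> \<in> solutions I M 1 0"
      using zero_in_coords by (auto simp: solutions_def lin_def one_G)
    ultimately show "x = \<one>\<^bsub>G\<^esub>" using ker by (metis card_1_singletonE singletonD)
  qed
  moreover have "\<phi> ` carrier G \<subseteq> carrier G" using closed by blast
  ultimately have "bij_betw \<phi> (carrier G) (carrier G)"
    using endo_inj_surj[OF finite_G] by (simp add: bij_betw_def)
  then have auto: "\<phi> \<in> auto G"
    using hom by (simp add: auto_def Bij_def \<phi>_def carrier_G)
  have "{x \<in> carrier G. \<phi> x [^]\<^bsub>G\<^esub> k = x} = solutions I M k 1" for k
    using fixed by (auto simp: solutions_def carrier_G)
  then have "Pi_fix p G \<phi> = p ^ m" using prod by (simp add: Pi_fix_eq[OF auto])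
  then show ?thesis using auto unfolding Spec_Pi_def by (intro CollectI exI[of _ \<phi>]) simp
qed

end

section \<open>The spectrum\<close>

theorem theorem4p10:
  fixes p n :: nat and e :: "nat list" and P :: "('a, 'b) monoid_scheme"
  assumes "Factorial_Ring.prime p"
    and "n \<ge> 1" and "e \<in> E n"
    and "finite_abelian_p_group p P" and "of_type p P e"
  shows "Spec_Pi p P = {p ^ m | m. m \<in> {b_num e + c_num e..sum_list e}}"
proof -
  have e: "sorted e" "\<forall>k\<in>set e. 1 \<le> k" using assms(3) by (auto simp: E_def)
  interpret cyclic_sum p "\<lambda>i. e ! i" "{..<length e}"
    using assms(1) e(2) by unfold_locales auto
  have "group P" using assms(4) by (auto simp: finite_abelian_p_group_def comm_group_def)
  moreover have "P \<cong> G" using assms(5) by (simp add: of_type_def G_def)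
  ultimately have "Spec_Pi p P = Spec_Pi p G" by (intro Spec_Pi_iso group_G)
  also have "\<dots> = {p ^ m | m. m \<in> {b_num e + c_num e..sum_list e}}"
  proof (intro equalityI subsetI)
    fix q assume "q \<in> Spec_Pi p G"
    then obtain \<phi> where \<phi>: "\<phi> \<in> auto G" and q: "q = Pi_fix p G \<phi>" by (auto simp: Spec_Pi_def)
    have "sparse (leaders e)"
      unfolding sparse_def
    proof (intro conjI ballI impI subsetI)
      fix t j assume "t \<in> leaders e" "j \<in> {..<length e}" "e ! j = e ! t"
      then show "j = t"
        using value_outside_a_blocks_unique[of t e j] leader_less_length leader_outside_a_blocks e(1) by auto
    qed (use leader_less_length leaders_not_consecutive[OF e(1)] in auto)
    from Pi_fix_bounds[OF \<phi> this] obtain m where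
      "q = p ^ m" "card (leaders e) \<le> m" "m \<le> (\<Sum>i<length e. e ! i)" using q by auto
    then show "q \<in> {p ^ m | m. m \<in> {b_num e + c_num e..sum_list e}}"
      by (auto simp: card_leaders sum_list_sum_nth atLeast0LessThan)
  next
    fix q assume "q \<in> {p ^ m | m. m \<in> {b_num e + c_num e..sum_list e}}"
    then obtain m where "q = p ^ m" "b_num e + c_num e \<le> m" "m \<le> sum_list e" by auto
    then show "q \<in> Spec_Pi p G"
      using realizable_between_block_count_and_sum[OF assms(1) e(2)] realizable_imp_Spec_Pi by auto
  qed
  finally show ?thesis .
qed

end
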